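(* Let $r:[s_0,\infty)\to(0,\infty)$ be a continuous non-increasing function. Let $$B_\infty=\{\Lambda\in X:\ a_s\Lambda\in K_{r(s)}\ \text{for an unbounded set of } s\ge s_0\}.$$ Then $$\sum_n r(n)\log\Big(\frac{1}{r(n)}\Big)<\infty\ \Longrightarrow\ \mu(B_\infty)=0.$$ If in addition the function $s\mapsto s+r(s)$ is non-decreasing, then $$\sum_n r(n)\log\Big(\frac{1}{r(n)}\Big)=\infty\ \Longrightarrow\ \mu(B_\infty)=1.$$ (The sums run over integers $n\ge s_0$.)
   Context: $X=\mathrm{SL}_2(\mathbb{R})/\mathrm{SL}_2(\mathbb{Z})$ is the space of unimodular lattices in $\mathbb{R}^2$, and $\mu$ is the $\mathrm{SL}_2(\mathbb{R})$-invariant probability measure on $X$. $\|\cdot\|$ denotes the supremum norm on $\mathbb{R}^2$. For $\Lambda\in X$ let $\Delta(\Lambda)=\sup_{v\in\Lambda\smallsetminus\{0\}}\log(1/\|v\|)$ (this is $\ge 0$), and for $r\ge0$ let $K_r=\Delta^{-1}([0,r])$, the set of lattices all of whose nonzero vectors have supremum norm at least $e^{-r}$. For $s\in\mathbb{R}$, $a_s=\mathrm{diag}(e^s,e^{-s})$, acting on $X$ by left multiplication.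
   Formalization: The formal theorem additionally assumes r(s) < 1 for all sufficiently large s; without this the first claim fails, e.g. for r ≡ 1 every term of the sum is 0 while μ(B_∞) = 1 by ergodicity. *)

theory Defs
  imports "HOL-Probability.Probability"
begin

definition SL2 :: "(real^2^2) set" where
  "SL2 = {g. det g = 1}"

definition Zvec :: "(real^2) set" where
  "Zvec = {v. \<forall>i. v $ i \<in> \<int>}"

text \<open>The lattice g Z^2 (the coset g SL_2(Z)).\<close>
definition lat :: "real^2^2 \<Rightarrow> (real^2) set" where
  "lat g = (\<lambda>z. g *v z) ` Zvec"

text \<open>X = SL_2(R)/SL_2(Z), the space of unimodular lattices in R^2.\<close>
definition Xlat :: "(real^2) set set" where
  "Xlat = lat ` SL2"

definition act :: "real^2^2 \<Rightarrow> (real^2) set \<Rightarrow> (real^2) set" where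
  "act g L = (\<lambda>v. g *v v) ` L"

definition Xmeas :: "(real^2) set measure" where
  "Xmeas = sigma Xlat {A. A \<subseteq> Xlat \<and> {g \<in> SL2. lat g \<in> A} \<in> sets borel}"

text \<open>M is an SL_2(R)-invariant probability measure on X (it is unique: the Haar measure mu).\<close>
definition haar_prob :: "(real^2) set measure \<Rightarrow> bool" where
  "haar_prob M \<longleftrightarrow> sets M = sets Xmeas \<and> prob_space M \<and>
     (\<forall>g\<in>SL2. \<forall>A\<in>sets M. emeasure M (act g -` A \<inter> Xlat) = emeasure M A)"

definition supnorm :: "real^2 \<Rightarrow> real" where
  "supnorm v = max \<bar>v $ 1\<bar> \<bar>v $ 2\<bar>"

definition Delta :: "(real^2) set \<Rightarrow> real" where
  "Delta L = Sup ((\<lambda>v. ln (1 / supnorm v)) ` (L - {0}))"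

definition Kset :: "real \<Rightarrow> (real^2) set set" where
  "Kset r = {L \<in> Xlat. Delta L \<le> r}"

definition amat :: "real \<Rightarrow> real^2^2" where
  "amat s = (\<chi> i j. if i = j then (if i = 1 then exp s else exp (- s)) else 0)"

definition Binf :: "(real \<Rightarrow> real) \<Rightarrow> real \<Rightarrow> (real^2) set set" where
  "Binf r s0 = {L \<in> Xlat. \<forall>T. \<exists>s \<ge> T. s0 \<le> s \<and> act (amat s) L \<in> Kset (r s)}"

end

(* Let u_t be the upper unipotent flow. It preserves the measure, so by Fubini it suffices to show
   that for every fixed lattice L the set of t with u_t L in B_infinity is null, resp. conull.

   For fixed L the minimal vectors v_0, v_1, ... of u_t L, with coordinates (X_k, y_k), follow a
   continued fraction algorithm v_(k+2) = v_k + a_k v_(k+1), and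
   |X_k| y_(k+1) + |X_(k+1)| y_k = 1. Hence a_s u_t L is in K_r for some s near a given maximal
   empty box iff |X_(k+1)| y_k is at most of order r, i.e. iff the product of two consecutive
   partial quotients is at least of order 1/r. Given the previous partial quotients, this has
   Lebesgue probability of order r log(1/r), as the cylinders are intervals of explicit length.
   Since log y_k grows linearly in k (always at least, and almost surely at most), the two halves of
   the theorem become the two halves of the Borel-Cantelli lemma; in the divergence part
   independence is replaced by multiplying conditional bounds along the tree of cylinders. *)

theory Submission
  imports Defs
begin

section \<open>Cylinders of basis pairs\<close>

text \<open>Partial quotients are not independent, but the proportion of a cylinder taken by each
  child is bounded above and below uniformly in the past, because the second coordinates of a pair
  are ordered. The logarithm comes from the ways of sharing a product between two digits: the first
  is a with probability of order 1/a^2, the second is then at least N/a with probability of order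
  a/N, and summing 1/(aN) over a < N gives (log N)/N. The obstacle is the change of clock:
  \<open>r\<close> is evaluated at the time s, while digits are counted by k. At the relevant times
  s is within a bounded distance of log y_k, so linear bounds in k are enough: \<open>r\<close> is
  monotone, and the convergence of a series with monotone terms is insensitive to a dilation of the
  index. The lower bound is deterministic; for the upper one, partial quotients have infinite mean,
  so a moment of order 1/2 is used. Digits are never treated as measurable functions of t:
  exceptional sets are countable unions of cylinders, and a fixed lattice offers only countably many
  starting pairs.\<close>

definition lform :: "real \<Rightarrow> real^2 \<Rightarrow> real" where
  "lform t v = v $ 1 + t * v $ 2"

definition cross2 :: "real^2 \<Rightarrow> real^2 \<Rightarrow> real" where
  "cross2 v w = v $ 1 * w $ 2 - v $ 2 * w $ 1"

lemma lform_add [simp]: "lform t (v + w) = lform t v + lform t w"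
  and lform_scaleR [simp]: "lform t (a *\<^sub>R v) = a * lform t v"
  and lform_diff [simp]: "lform t (v - w) = lform t v - lform t w"
  and lform_minus [simp]: "lform t (- v) = - lform t v"
  by (auto simp: lform_def algebra_simps)

lemma cross2_lform: "cross2 v w = lform t v * w $ 2 - lform t w * v $ 2"
  by (simp add: cross2_def lform_def algebra_simps)

text \<open>For a basis \<open>v\<close>, \<open>w\<close> with non-negative second coordinates, \<open>t\<close> lies in the cylinder iff
  \<open>lform t v\<close> and \<open>lform t w\<close> have opposite signs and the latter is the smaller one in absolute value.
  Then no lattice vector is strictly smaller than \<open>v\<close> in the first and than \<open>w\<close> in the second
  coordinate. The sign condition is written with \<open>v + w\<close> so that the cylinder is visibly an interval.\<close>

definition cyl :: "(real^2) \<times> (real^2) \<Rightarrow> real set" where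
  "cyl P = {t. lform t (snd P) * lform t (fst P + snd P) < 0}"

text \<open>One step of the continued fraction algorithm. The partial quotient is \<open>a + 1\<close>, so that digits
  range over all natural numbers.\<close>

definition child :: "nat \<Rightarrow> (real^2) \<times> (real^2) \<Rightarrow> (real^2) \<times> (real^2)" where
  "child a P = (snd P, fst P + real (Suc a) *\<^sub>R snd P)"

text \<open>The absolute value is taken because each step reverses the orientation. Only the first
  vector may be horizontal.\<close>

definition pair_ok :: "(real^2) \<times> (real^2) \<Rightarrow> bool" where
  "pair_ok P \<longleftrightarrow> \<bar>cross2 (fst P) (snd P)\<bar> = 1 \<and> 0 \<le> fst P $ 2 \<and> fst P $ 2 \<le> snd P $ 2 \<and> 0 < snd P $ 2"

text \<open>The length of \<open>cyl P\<close>: its ends are the zeros of the forms of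
  \<open>snd P\<close> and \<open>fst P + snd P\<close>, two quotients whose difference is the
  determinant over the product of the denominators.\<close>

definition len :: "(real^2) \<times> (real^2) \<Rightarrow> real" where
  "len P = 1 / (snd P $ 2 * (fst P $ 2 + snd P $ 2))"

lemma pair_ok_child:
  assumes "pair_ok P" shows "pair_ok (child a P)"
proof -
  have "cross2 (snd P) (fst P + real (Suc a) *\<^sub>R snd P) = - cross2 (fst P) (snd P)"
    by (simp add: cross2_def algebra_simps)
  moreover have "snd P $ 2 * 1 \<le> snd P $ 2 * real (Suc a)"
    using assms by (intro mult_left_mono) (auto simp: pair_ok_def)
  ultimately show ?thesis
    using assms by (simp add: pair_ok_def child_def) (simp add: algebra_simps add_nonneg_pos add_pos_nonneg)
qed

lemma len_pos: "pair_ok P \<Longrightarrow> 0 < len P"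
  by (auto simp: pair_ok_def len_def intro!: divide_pos_pos mult_pos_pos add_nonneg_pos)

lemma cyl_measurable [measurable]: "cyl P \<in> sets borel"
proof -
  have "open (cyl P)"
    unfolding cyl_def lform_def by (intro open_Collect_less continuous_intros)
  then show ?thesis by simp
qed

lemma emeasure_cyl:
  assumes "pair_ok P" shows "emeasure lborel (cyl P) = ennreal (len P)"
proof -
  define v w where "v = fst P" and "w = snd P"
  have ok: "\<bar>cross2 v w\<bar> = 1" "0 \<le> v $ 2" "0 < w $ 2"
    using assms by (auto simp: pair_ok_def v_def w_def)
  define \<alpha> \<beta> where "\<alpha> = - (w $ 1) / w $ 2" and "\<beta> = - (v $ 1 + w $ 1) / (v $ 2 + w $ 2)"
  have s: "v $ 2 + w $ 2 > 0" using ok by simp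
  have "lform t w * lform t (v + w) = (w $ 2 * (v $ 2 + w $ 2)) * ((t - \<alpha>) * (t - \<beta>))" for t
  proof -
    have "lform t w = w $ 2 * (t - \<alpha>)" using ok by (simp add: lform_def \<alpha>_def field_simps)
    moreover have "lform t (v + w) = (v $ 2 + w $ 2) * (t - \<beta>)"
      using s by (simp add: lform_def \<beta>_def field_simps)
    ultimately show ?thesis by (simp only: mult_ac)
  qed
  moreover have "0 < w $ 2 * (v $ 2 + w $ 2)" using ok s by simp
  ultimately have "cyl P = {t. (t - \<alpha>) * (t - \<beta>) < 0}"
    unfolding cyl_def v_def[symmetric] w_def[symmetric] by (simp add: mult_less_0_iff[of "w $ 2 * _"])
  also have "\<dots> = {min \<alpha> \<beta><..<max \<alpha> \<beta>}"
    by (auto simp: mult_less_0_iff min_def max_def)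
  finally have "emeasure lborel (cyl P) = ennreal \<bar>\<alpha> - \<beta>\<bar>"
    by (simp add: max_def min_def abs_real_def)
  moreover have "\<alpha> - \<beta> = cross2 v w / (w $ 2 * (v $ 2 + w $ 2))"
    using ok s by (simp add: \<alpha>_def \<beta>_def cross2_def field_simps)
  then have "\<bar>\<alpha> - \<beta>\<bar> = len P"
    using ok s by (simp add: len_def v_def[symmetric] w_def[symmetric] abs_mult)
  ultimately show ?thesis by simp
qed

section \<open>Proportions of a cylinder occupied by its children\<close>

lemma pos_add_Suc_mult:
  fixes x y :: real
  assumes "0 \<le> x" "0 < y" shows "0 < x + real (Suc n) * y"
  using assms by (intro add_nonneg_pos mult_pos_pos) auto

text \<open>Child \<open>a\<close> is the interval between the zeros of the forms of
  \<open>fst P + (a+1) snd P\<close> and \<open>fst P + (a+2) snd P\<close>. These zeros converge to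
  that of \<open>snd P\<close>, so the lengths telescope.\<close>

lemma len_child_sums:
  assumes "pair_ok P"
  shows "(\<lambda>a. len (child (a + m) P)) sums (1 / (snd P $ 2 * (fst P $ 2 + real (Suc m) * snd P $ 2)))"
proof -
  define x y where "x = fst P $ 2" and "y = snd P $ 2"
  have xy: "0 \<le> x" "0 < y" using assms by (auto simp: pair_ok_def x_def y_def)
  \<comment> \<open>The distance between the zeros of the forms of
    \<open>fst P + Suc (a + m) snd P\<close> and \<open>snd P\<close>.\<close>
  define f where "f a = 1 / (y * (x + real (Suc (a + m)) * y))" for a
  have f: "f a > 0" for a
    unfolding f_def using xy by (intro divide_pos_pos mult_pos_pos pos_add_Suc_mult) auto
  have e: "len (child (a + m) P) = f a - f (Suc a)" for a
  proof -
    have "x + real (Suc (a + m)) * y > 0" "x + real (Suc (Suc a + m)) * y > 0"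
      using xy by (simp_all only: pos_add_Suc_mult)
    then have "f a - f (Suc a) = 1 / ((x + real (Suc (a + m)) * y) * (x + real (Suc (Suc a + m)) * y))"
      using xy by (simp add: f_def divide_simps) (simp add: algebra_simps)
    then show ?thesis by (simp add: len_def child_def x_def y_def algebra_simps)
  qed
  have "f \<longlonglongrightarrow> 0"
  proof (rule tendsto_sandwich[OF _ _ tendsto_const])
    show "\<forall>\<^sub>F n in sequentially. 0 \<le> f n" using f by (simp add: less_imp_le)
    show "(\<lambda>n. (1 / y\<^sup>2) * inverse (real (Suc n))) \<longlonglongrightarrow> 0"
      by (rule tendsto_mult_right_zero[OF LIMSEQ_inverse_real_of_nat])
    have "f n \<le> (1 / y\<^sup>2) * inverse (real (Suc n))" for n
    proof -
      have "y * (real (Suc n) * y) \<le> y * (x + real (Suc (n + m)) * y)"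
        using xy by (intro mult_left_mono add_increasing[OF xy(1)] mult_right_mono) auto
      then have "f n \<le> 1 / (y * (real (Suc n) * y))"
        unfolding f_def using xy by (intro divide_left_mono mult_pos_pos pos_add_Suc_mult) auto
      then show ?thesis using xy by (simp add: power2_eq_square field_simps)
    qed
    then show "\<forall>\<^sub>F n in sequentially. f n \<le> (1 / y\<^sup>2) * inverse (real (Suc n))" by simp
  qed
  from telescope_sums'[OF this] have "(\<lambda>a. f a - f (Suc a)) sums f 0" by simp
  then show ?thesis by (simp add: e f_def x_def y_def)
qed

lemma len_child_sums0:
  assumes "pair_ok P" shows "(\<lambda>a. len (child a P)) sums len P"
  using len_child_sums[OF assms, of 0] by (simp add: len_def)

text \<open>With x, y the second coordinates of the pair, digits at least \<open>m\<close> fill the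
  proportion (x + y) / (x + (m+1) y) of the cylinder. It increases with x, and x = 0 gives the least
  value 1/(m+1).\<close>

lemma sum_len_child:
  assumes "pair_ok P"
  shows "(\<Sum>a<m. len (child a P)) \<le> len P * (1 - 1 / real (Suc m))"
proof -
  define x y where "x = fst P $ 2" and "y = snd P $ 2"
  have xy: "0 \<le> x" "0 < y" using assms by (auto simp: pair_ok_def x_def y_def)
  have "len P = (\<Sum>a<m. len (child a P)) + 1 / (y * (x + real (Suc m) * y))"
    using sums_unique2[OF sums_split_initial_segment[OF len_child_sums0[OF assms], of m]
        len_child_sums[OF assms, of m]] by (simp add: x_def y_def)
  moreover have "len P / real (Suc m) \<le> 1 / (y * (x + real (Suc m) * y))"
  proof -
    have "y * (x + real (Suc m) * y) \<le> y * (x + y) * real (Suc m)"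
      using xy by (simp add: algebra_simps)
    then have "1 / (y * (x + y) * real (Suc m)) \<le> 1 / (y * (x + real (Suc m) * y))"
      using xy by (intro divide_left_mono mult_pos_pos pos_add_Suc_mult) auto
    then show ?thesis by (simp add: len_def x_def y_def)
  qed
  ultimately show ?thesis by (simp add: right_diff_distrib)
qed

text \<open>The same proportion at its other extreme, x = y.\<close>

lemma tail_len_child:
  assumes "pair_ok P"
  obtains c where "(\<lambda>a. len (child (a + m) P)) sums c" "c \<le> len P * (2 / real (m + 2))"
proof -
  define x y where "x = fst P $ 2" and "y = snd P $ 2"
  have xy: "0 \<le> x" "x \<le> y" "0 < y" using assms by (auto simp: pair_ok_def x_def y_def)
  have "(x + y) * real (m + 2) \<le> 2 * (x + real (Suc m) * y)"
    using mult_right_mono[of x y "real m"] xy by (simp add: algebra_simps)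
  then have "y * (x + y) * real (m + 2) \<le> 2 * (y * (x + real (Suc m) * y))"
    using xy mult_left_mono[of "(x + y) * real (m + 2)" "2 * (x + real (Suc m) * y)" y]
    by (simp only: mult.assoc mult.left_commute)
  moreover have "0 < x + real (Suc m) * y" using xy(1,3) by (rule pos_add_Suc_mult)
  ultimately have "1 / (y * (x + real (Suc m) * y)) \<le> len P * (2 / real (m + 2))"
    using xy by (simp add: len_def x_def[symmetric] y_def[symmetric] divide_simps mult_ac)
  then show ?thesis using that len_child_sums[OF assms, of m] by (simp add: x_def y_def)
qed

text \<open>Bounded distortion: since 0 <= x <= y, the conditional probability of a digit is of
  order 1/(a+1)^2 whatever the previous digits are. This is the substitute for independence.\<close>

lemma len_child_bounds:
  assumes "pair_ok P"
  shows "len P / ((real a + 2) * (real a + 3)) \<le> len (child a P)"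
    and "len (child a P) \<le> 2 * len P / ((real a + 1) * (real a + 2))"
proof -
  define x y where "x = fst P $ 2" and "y = snd P $ 2"
  have xy: "0 \<le> x" "x \<le> y" "0 < y" using assms by (auto simp: pair_ok_def x_def y_def)
  have pos: "0 < x + y" "0 < x + (real a + 1) * y" "0 < x + (real a + 2) * y"
    using xy by (auto intro!: add_nonneg_pos mult_pos_pos)
  have l: "len (child a P) = 1 / ((x + (real a + 1) * y) * (x + (real a + 2) * y))"
    by (simp add: len_def child_def x_def y_def algebra_simps)
  have l0: "len P = 1 / (y * (x + y))" by (simp add: len_def x_def y_def)
  have "(x + (real a + 1) * y) * (x + (real a + 2) * y) \<le> ((real a + 2) * (x + y)) * ((real a + 3) * y)"
    using xy pos by (intro mult_mono) (auto simp: algebra_simps)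
  also have "\<dots> = (y * (x + y)) * ((real a + 2) * (real a + 3))" by (simp add: algebra_simps)
  finally show "len P / ((real a + 2) * (real a + 3)) \<le> len (child a P)"
    using pos xy by (simp add: l l0 divide_simps mult_ac)
  have "(y * (x + y)) * ((real a + 1) * (real a + 2)) = ((real a + 1) * y) * ((real a + 2) * (x + y))"
    by (simp add: algebra_simps)
  also have "\<dots> \<le> (x + (real a + 1) * y) * (2 * (x + (real a + 2) * y))"
  proof (rule mult_mono)
    have "real a * x \<le> real a * y" "0 \<le> real a * y" using xy by (auto intro: mult_left_mono)
    then show "(real a + 2) * (x + y) \<le> 2 * (x + (real a + 2) * y)"
      using xy unfolding distrib_right distrib_left by linarith
  qed (use xy pos in auto)
  also have "\<dots> = 2 * ((x + (real a + 1) * y) * (x + (real a + 2) * y))"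
    by (simp only: mult.left_commute)
  finally show "len (child a P) \<le> 2 * len P / ((real a + 1) * (real a + 2))"
    using pos xy by (simp add: l l0 divide_simps mult_ac)
qed

text \<open>All measure estimates of the proof are upper bounds, also in the divergence half, where
  the set without large products is estimated. Hence subadditivity suffices.\<close>

lemma emeasure_UN_le:
  assumes "\<And>a::nat. A a \<in> sets M" "\<And>a. emeasure M (A a) \<le> ennreal (f a)" "\<And>a. 0 \<le> f a"
    and "f sums F"
  shows "emeasure M (\<Union>a. A a) \<le> ennreal F"
proof -
  have "emeasure M (\<Union>a. A a) \<le> (\<Sum>a. emeasure M (A a))"
    using assms(1) by (intro emeasure_subadditive_countably) auto
  also have "\<dots> \<le> (\<Sum>a. ennreal (f a))" using assms(2) by (intro suminf_le) auto
  also have "\<dots> = ennreal F" using assms(3,4) by (simp add: suminf_ennreal2 sums_iff)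
  finally show ?thesis .
qed

section \<open>Measures of digit conditions\<close>

text \<open>In terms of the partial quotients \<open>a\<^sub>k\<close> = digit + 1, \<open>bad\<close> contains the points with
  \<open>a\<^bsub>2j\<^esub> a\<^bsub>2j+1\<^esub> < N j\<close> for all \<open>j < n\<close> (disjoint pairs of digits, so that the conditional measures
  multiply), \<open>hit\<close> those with \<open>a\<^sub>n a\<^bsub>n+1\<^esub> \<ge> N\<close>, and \<open>grow\<close> those with a large second
  coordinate after \<open>n\<close> steps. The definitions through unions of cylinders give measurability for free;
  \<open>N div Suc a\<close> is a rounded form of the product condition.\<close>

fun bad :: "nat \<Rightarrow> (nat \<Rightarrow> nat) \<Rightarrow> (real^2) \<times> (real^2) \<Rightarrow> real set" where
  "bad 0 N P = cyl P"
| "bad (Suc n) N P = (\<Union>a. \<Union>b\<in>{..<N 0 div Suc a}. bad n (\<lambda>j. N (Suc j)) (child b (child a P)))"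

fun hit :: "nat \<Rightarrow> nat \<Rightarrow> (real^2) \<times> (real^2) \<Rightarrow> real set" where
  "hit 0 N P = (\<Union>a. \<Union>b\<in>{b. N div Suc a \<le> Suc b}. cyl (child b (child a P)))"
| "hit (Suc n) N P = (\<Union>a. hit n N (child a P))"

fun grow :: "nat \<Rightarrow> real \<Rightarrow> (real^2) \<times> (real^2) \<Rightarrow> real set" where
  "grow 0 l P = (if l < snd P $ 2 then cyl P else {})"
| "grow (Suc n) l P = (\<Union>a. grow n l (child a P))"

lemma bad_sets [measurable]: "bad n N P \<in> sets borel"
  by (induction n N P rule: bad.induct) (auto simp: cyl_measurable)

lemma hit_sets [measurable]: "hit n N P \<in> sets borel"
  by (induction n N P rule: hit.induct) (auto simp: cyl_measurable intro!: sets.countable_UN')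

lemma grow_sets [measurable]: "grow n l P \<in> sets borel"
  by (induction n l P rule: grow.induct) (auto simp: cyl_measurable)

lemma emeasure_UN_lessThan_le:
  assumes "\<And>b::nat. A b \<in> sets M" "\<And>b. emeasure M (A b) \<le> ennreal (f b)" "\<And>b. 0 \<le> f b"
  shows "emeasure M (\<Union>b\<in>{..<m}. A b) \<le> ennreal (\<Sum>b<m. f b)"
proof -
  have "emeasure M (\<Union>b\<in>{..<m}. A b) \<le> (\<Sum>b<m. emeasure M (A b))"
    using assms(1) by (intro emeasure_subadditive_finite) auto
  also have "\<dots> \<le> (\<Sum>b<m. ennreal (f b))" using assms(2) by (intro sum_mono) auto
  also have "\<dots> = ennreal (\<Sum>b<m. f b)" using assms(3) by (simp add: sum_ennreal)
  finally show ?thesis .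
qed

lemma harm_eq_sum: "harm n = (\<Sum>a<n. 1 / (real a + 1))"
  by (simp add: harm_altdef inverse_eq_divide add.commute)

lemma harm_le: "harm n \<le> real n"
proof -
  have "(\<Sum>a<n. 1 / (real a + 1)) \<le> (\<Sum>a<n. 1)" by (intro sum_mono) simp
  then show ?thesis by (simp add: harm_eq_sum)
qed

text \<open>One pair of digits contributes one factor. For \<open>a < N\<close>, the first digit
  \<open>a\<close> has proportion at least 1/((a+2)(a+3)), and the excluded second digits have at
  least 1/(N div (a+1) + 1) >= (a+1)/(2N) of that; the product is at least 1/(12 N (a+1)), and
  summing over \<open>a < N\<close> produces \<open>harm N / (12 N)\<close>.\<close>

lemma emeasure_bad_le:
  assumes "pair_ok P" "\<And>j. 1 \<le> N j"
  shows "emeasure lborel (bad n N P) \<le> ennreal (len P * (\<Prod>j<n. 1 - harm (N j) / (12 * real (N j))))"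
  using assms
proof (induction n arbitrary: N P)
  case 0
  then show ?case by (simp add: emeasure_cyl)
next
  case (Suc n)
  define N' where "N' j = N (Suc j)" for j
  define c where "c = (\<Prod>j<n. 1 - harm (N' j) / (12 * real (N' j)))"
  define M where "M = real (N 0)"
  have M: "1 \<le> M" using Suc.prems by (simp add: M_def)
  have c: "0 \<le> c"
    unfolding c_def
  proof (intro prod_nonneg ballI)
    fix j
    have "harm (N' j) / (12 * real (N' j)) \<le> 1"
      using Suc.prems(2)[of "Suc j"] harm_le[of "N' j"] by (simp add: N'_def divide_le_eq)
    then show "0 \<le> 1 - harm (N' j) / (12 * real (N' j))" by simp
  qed
  define B where "B a = (\<Union>b\<in>{..<N 0 div Suc a}. bad n N' (child b (child a P)))" for a
  define g where "g a = c * (len (child a P) - (if a < N 0 then len P / (12 * M * (real a + 1)) else 0))" for a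
  have Bset: "B a \<in> sets borel" for a unfolding B_def by measurable
  have B: "emeasure lborel (B a) \<le> ennreal (c * (len (child a P) * (1 - 1 / real (Suc (N 0 div Suc a)))))" for a
  proof -
    have oka: "pair_ok (child a P)" using Suc.prems(1) by (rule pair_ok_child)
    have "emeasure lborel (B a) \<le> ennreal (\<Sum>b<N 0 div Suc a. len (child b (child a P)) * c)"
      unfolding B_def
    proof (intro emeasure_UN_lessThan_le)
      fix b
      have ok: "pair_ok (child b (child a P))" using oka by (rule pair_ok_child)
      show "emeasure lborel (bad n N' (child b (child a P))) \<le> ennreal (len (child b (child a P)) * c)"
        unfolding c_def using Suc.prems(2) by (intro Suc.IH ok) (auto simp: N'_def)
      show "0 \<le> len (child b (child a P)) * c" using len_pos[OF ok] c by simp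
    qed auto
    also have "\<dots> \<le> ennreal (c * (len (child a P) * (1 - 1 / real (Suc (N 0 div Suc a)))))"
    proof (rule ennreal_leI)
      have "(\<Sum>b<N 0 div Suc a. len (child b (child a P)) * c) = c * (\<Sum>b<N 0 div Suc a. len (child b (child a P)))"
        by (simp add: sum_distrib_left mult.commute)
      also have "\<dots> \<le> c * (len (child a P) * (1 - 1 / real (Suc (N 0 div Suc a))))"
        by (intro mult_left_mono sum_len_child oka c)
      finally show "(\<Sum>b<N 0 div Suc a. len (child b (child a P)) * c)
          \<le> c * (len (child a P) * (1 - 1 / real (Suc (N 0 div Suc a))))" .
    qed
    finally show ?thesis .
  qed
  have key: "c * (len (child a P) * (1 - 1 / real (Suc (N 0 div Suc a)))) \<le> g a" for a
  proof (cases "a < N 0")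
    case True
    have "real (N 0 div Suc a) \<le> M / (real a + 1)"
      using of_nat_div_le_of_nat[of "N 0" "Suc a", where ?'a=real] by (simp add: M_def add.commute)
    then have "real (Suc (N 0 div Suc a)) \<le> M / (real a + 1) + 1" by simp
    also have "\<dots> \<le> 2 * M / (real a + 1)"
    proof -
      have "real a + 1 \<le> M" using True by (simp add: M_def)
      then have "1 \<le> M / (real a + 1)" by (simp add: le_divide_eq)
      moreover have "2 * M / (real a + 1) = M / (real a + 1) + M / (real a + 1)" by simp
      ultimately show ?thesis by linarith
    qed
    finally have "1 / (2 * M / (real a + 1)) \<le> 1 / real (Suc (N 0 div Suc a))"
      by (intro divide_left_mono) (use M in auto)
    then have 1: "(real a + 1) / (2 * M) \<le> 1 / real (Suc (N 0 div Suc a))" by simp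
    have "len P / (12 * M * (real a + 1)) \<le> len P / ((real a + 2) * (real a + 3)) * ((real a + 1) / (2 * M))"
    proof -
      \<comment> \<open>Equality at \<open>a = 0\<close>. This 6 and the 2 in (a+1)/(2M) make the
        constant 12.\<close>
      have "(real a + 2) * (real a + 3) \<le> 6 * (real a + 1) * (real a + 1)" by (simp add: algebra_simps)
      then have "1 / (6 * (real a + 1)) \<le> (real a + 1) / ((real a + 2) * (real a + 3))"
        by (simp add: divide_simps mult_ac)
      then have "len P / (2 * M) * (1 / (6 * (real a + 1))) \<le> len P / (2 * M) * ((real a + 1) / ((real a + 2) * (real a + 3)))"
        using M len_pos[OF Suc.prems(1)] by (intro mult_left_mono) auto
      then show ?thesis by (simp add: mult_ac)
    qed
    also have "\<dots> \<le> len (child a P) * (1 / real (Suc (N 0 div Suc a)))"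
      using 1 len_child_bounds(1)[OF Suc.prems(1), of a] len_pos[OF pair_ok_child[OF Suc.prems(1)], of a] M
      by (intro mult_mono) auto
    finally have "len (child a P) * (1 - 1 / real (Suc (N 0 div Suc a)))
        \<le> len (child a P) - len P / (12 * M * (real a + 1))"
      by (simp only: right_diff_distrib)
    then show ?thesis using True c unfolding g_def by (simp only: if_True mult_left_mono)
  next
    case False
    then show ?thesis using c len_pos[OF pair_ok_child[OF Suc.prems(1)], of a] by (simp add: g_def)
  qed
  have gs: "g sums (c * (len P - (\<Sum>a<N 0. len P / (12 * M * (real a + 1)))))"
    unfolding g_def
    by (intro sums_mult sums_diff len_child_sums0 Suc.prems sums_If_finite_set[of "{..<N 0}", simplified lessThan_iff]) auto
  have "harm (N 0) = (\<Sum>a<N 0. 1 / (real a + 1))"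
    by (rule harm_eq_sum)
  then have hs: "(\<Sum>a<N 0. len P / (12 * M * (real a + 1))) = len P * (harm (N 0) / (12 * M))"
    by (simp add: sum_distrib_left sum_divide_distrib mult_ac)
  have "emeasure lborel (\<Union>a. B a) \<le> ennreal (c * (len P - (\<Sum>a<N 0. len P / (12 * M * (real a + 1)))))"
  proof (rule emeasure_UN_le[OF _ _ _ gs])
    show "B a \<in> sets lborel" for a using Bset by simp
    show "emeasure lborel (B a) \<le> ennreal (g a)" for a
      using B[of a] ennreal_leI[OF key[of a]] by (rule order_trans)
    have "0 \<le> c * (len (child a P) * (1 - 1 / real (Suc (N 0 div Suc a))))" for a
      using c len_pos[OF pair_ok_child[OF Suc.prems(1)], of a] by (intro mult_nonneg_nonneg) auto
    then show "0 \<le> g a" for a using key[of a] by (rule order_trans)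
  qed
  moreover have "c * (len P - len P * (harm (N 0) / (12 * M))) =
      len P * (\<Prod>j<Suc n. 1 - harm (N j) / (12 * real (N j)))" (is "_ = ?r")
    unfolding prod.lessThan_Suc_shift by (simp add: c_def N'_def M_def algebra_simps)
  ultimately have "emeasure lborel (\<Union>a. B a) \<le> ennreal ?r" by (simp only: hs)
  then show ?case unfolding bad.simps B_def N'_def .
qed

lemma prod_one_minus_tendsto_0:
  fixes x :: "nat \<Rightarrow> real"
  assumes "\<And>j. 0 \<le> x j" "\<And>j. x j \<le> 1" "\<not> summable x"
  shows "(\<lambda>n. \<Prod>j<n. 1 - x j) \<longlonglongrightarrow> 0"
proof (rule tendsto_sandwich[OF _ _ tendsto_const])
  show "\<forall>\<^sub>F n in sequentially. 0 \<le> (\<Prod>j<n. 1 - x j)"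
    using assms(2) by (auto intro!: prod_nonneg always_eventually)
  have "(\<Prod>j<n. 1 - x j) \<le> exp (- (\<Sum>j<n. x j))" for n
  proof -
    have "(\<Prod>j<n. 1 - x j) \<le> (\<Prod>j<n. exp (- x j))"
      using assms(2) exp_ge_add_one_self[of "- x _"] by (intro prod_mono) auto
    then show ?thesis by (simp add: exp_sum sum_negf[symmetric])
  qed
  then show "\<forall>\<^sub>F n in sequentially. (\<Prod>j<n. 1 - x j) \<le> exp (- (\<Sum>j<n. x j))" by simp
  have "filterlim (\<lambda>n. \<Sum>j<n. x j) at_top sequentially"
  proof -
    have inc: "incseq (\<lambda>n. \<Sum>j<n. x j)" using assms(1) by (intro incseq_SucI) simp
    show ?thesis unfolding filterlim_at_top
    proof
      fix B
      have "\<exists>n. B \<le> (\<Sum>j<n. x j)"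
      proof (rule ccontr)
        assume "\<nexists>n. B \<le> (\<Sum>j<n. x j)"
        then have "(\<Sum>j<n. x j) \<le> B" for n by (meson nle_le)
        then have "(\<Sum>j\<le>n. x j) \<le> B" for n by (simp add: lessThan_Suc_atMost[symmetric] del: sum.lessThan_Suc)
        then have "summable x" using assms(1) by (intro bounded_imp_summable[where B=B]) auto
        with assms(3) show False by simp
      qed
      then obtain n where "B \<le> (\<Sum>j<n. x j)" ..
      then show "\<forall>\<^sub>F m in sequentially. B \<le> (\<Sum>j<m. x j)"
        unfolding eventually_sequentially using incseqD[OF inc, of n] by (intro exI[of _ n]) (auto intro: order_trans)
    qed
  qed
  then show "(\<lambda>n. exp (- (\<Sum>j<n. x j))) \<longlonglongrightarrow> 0"
    by (intro filterlim_compose[OF exp_at_bot, of "\<lambda>n. - (\<Sum>j<n. x j)"] filterlim_uminus_at_bot[THEN iffD2]) simp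
qed

lemma null_bad:
  assumes "pair_ok P" "\<And>j. 1 \<le> N j" "\<not> summable (\<lambda>j. harm (N j) / real (N j) :: real)"
  shows "(\<Inter>n. bad n N P) \<in> null_sets lborel"
proof -
  have "\<not> summable (\<lambda>j. harm (N j) / (12 * real (N j)))"
  proof
    assume "summable (\<lambda>j. harm (N j) / (12 * real (N j)))"
    from summable_mult[OF this, of 12] have "summable (\<lambda>j. harm (N j) / real (N j) :: real)" by simp
    with assms(3) show False by simp
  qed
  then have "(\<lambda>n. \<Prod>j<n. 1 - harm (N j) / (12 * real (N j))) \<longlonglongrightarrow> 0"
  proof (rule prod_one_minus_tendsto_0[rotated 2])
    fix j
    show "harm (N j) / (12 * real (N j)) \<le> 1"
      using assms(2)[of j] harm_le[of "N j"] by (simp add: divide_le_eq)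
  qed (simp add: harm_nonneg)
  then have "(\<lambda>n. ennreal (len P * (\<Prod>j<n. 1 - harm (N j) / (12 * real (N j))))) \<longlonglongrightarrow> ennreal 0"
    by (intro tendsto_ennrealI tendsto_mult_right_zero)
  then have "emeasure lborel (\<Inter>n. bad n N P) \<le> ennreal 0"
  proof (rule LIMSEQ_le_const)
    have "emeasure lborel (\<Inter>n. bad n N P) \<le> ennreal (len P * (\<Prod>j<n. 1 - harm (N j) / (12 * real (N j))))" for n
    proof -
      have "emeasure lborel (\<Inter>n. bad n N P) \<le> emeasure lborel (bad n N P)"
        by (intro emeasure_mono) auto
      with emeasure_bad_le[of P N n] assms show ?thesis by (meson order_trans)
    qed
    then show "\<exists>k. \<forall>n\<ge>k. emeasure lborel (\<Inter>n. bad n N P) \<le> ennreal (len P * (\<Prod>j<n. 1 - harm (N j) / (12 * real (N j))))"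
      by blast
  qed
  then show ?thesis by (auto intro!: null_setsI)
qed

text \<open>For \<open>n = 0\<close>, first digits \<open>a < N\<close> contribute 2/((a+1)(a+2))
  times a tail of at most 2(a+1)/N, in total at most 4 \<open>harm N / N\<close>; for first digits
  from \<open>N\<close> on the second digit is ignored, which costs at most 2/(N+2). Further leading
  digits leave the proportion unchanged, as the children's lengths add up to that of the
  parent.\<close>

lemma emeasure_hit_le:
  assumes "pair_ok P" "1 \<le> N"
  shows "emeasure lborel (hit n N P) \<le> ennreal (6 * harm N / real N * len P)"
  using assms(1)
proof (induction n arbitrary: P)
  case 0
  define M where "M = real N"
  have M: "1 \<le> M" using assms by (simp add: M_def)
  define A where "A a = (\<Union>b\<in>{b. N div Suc a \<le> Suc b}. cyl (child b (child a P)))" for a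
  define f where "f a = (if a < N then 4 * len P / (M * (real a + 1)) else 0) + (if a < N then 0 else len (child a P))" for a
  have A: "emeasure lborel (A a) \<le> ennreal (f a)" for a
  proof -
    define m where "m = N div Suc a - 1"
    have ok: "pair_ok (child a P)" using 0 by (rule pair_ok_child)
    obtain s where s: "(\<lambda>b. len (child (b + m) (child a P))) sums s" "s \<le> len (child a P) * (2 / real (m + 2))"
      by (rule tail_len_child[OF ok])
    have Aeq: "A a = (\<Union>b. cyl (child (b + m) (child a P)))"
    proof -
      have "{b. N div Suc a \<le> Suc b} = range (\<lambda>b. b + m)"
      proof safe
        fix b assume "N div Suc a \<le> Suc b"
        then have "b = (b - m) + m" by (simp add: m_def)
        then show "b \<in> range (\<lambda>b. b + m)" by blast
      qed (simp add: m_def)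
      then show ?thesis by (simp add: A_def)
    qed
    have "emeasure lborel (A a) \<le> ennreal s" unfolding Aeq
      by (rule emeasure_UN_le[OF _ _ _ s(1)])
        (auto simp: cyl_measurable emeasure_cyl pair_ok_child ok less_imp_le len_pos)
    also have "s \<le> f a"
    proof (cases "a < N")
      case True
      have "M / (real a + 1) < real (Suc (N div Suc a))"
      proof -
        have "N < Suc a * Suc (N div Suc a)"
          using dividend_less_times_div[of "Suc a" N] by simp
        then have "M < real (Suc a) * real (Suc (N div Suc a))"
          unfolding M_def of_nat_mult[symmetric] of_nat_less_iff .
        then show ?thesis by (simp add: divide_less_eq mult_ac add.commute)
      qed
      also have "\<dots> \<le> real (m + 2)" by (simp add: m_def)
      finally have "2 / real (m + 2) \<le> 2 / (M / (real a + 1))"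
        using M by (intro divide_left_mono) (auto intro!: mult_pos_pos)
      then have "s \<le> (2 * len P / ((real a + 1) * (real a + 2))) * (2 * (real a + 1) / M)"
        using len_child_bounds(2)[OF 0, of a] len_pos[OF 0] M
        by (intro order_trans[OF s(2)] mult_mono) auto
      also have "\<dots> = 4 * len P / (M * (real a + 2))"
      proof -
        have "real a + 1 \<noteq> 0" "real a + 2 \<noteq> 0" "M \<noteq> 0" using M by linarith+
        then show ?thesis by (simp add: divide_simps)
      qed
      also have "\<dots> \<le> 4 * len P / (M * (real a + 1))"
        using M len_pos[OF 0] by (intro divide_left_mono mult_left_mono mult_pos_pos) auto
      finally show ?thesis using True by (simp add: f_def)
    next
      case False
      have "len (child a P) * (2 / real (m + 2)) \<le> len (child a P) * 1"
        using len_pos[OF ok] by (intro mult_left_mono) auto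
      then show ?thesis using False s(2) by (simp add: f_def)
    qed
    finally show ?thesis by (simp add: ennreal_leI)
  qed
  obtain s where s: "(\<lambda>b. len (child (b + N) P)) sums s" "s \<le> len P * (2 / real (N + 2))"
    by (rule tail_len_child[OF 0])
  have "(\<lambda>a. if a < N then 0 else len (child a P)) sums s"
    using s(1) by (subst sums_iff_shift'[of _ N, symmetric]) simp
  then have "f sums ((\<Sum>a<N. 4 * len P / (M * (real a + 1))) + s)"
    unfolding f_def
    by (intro sums_add sums_If_finite_set[of "{..<N}", simplified lessThan_iff]) auto
  then have "emeasure lborel (\<Union>a. A a) \<le> ennreal ((\<Sum>a<N. 4 * len P / (M * (real a + 1))) + s)"
  proof (rule emeasure_UN_le[rotated 3])
    show "emeasure lborel (A a) \<le> ennreal (f a)" for a by (rule A)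
    show "A a \<in> sets lborel" for a
      unfolding A_def by (auto simp: cyl_measurable intro!: sets.countable_UN')
    show "0 \<le> f a" for a
      using M len_pos[OF 0] len_pos[OF pair_ok_child[OF 0], of a] by (simp add: f_def)
  qed
  also have "(\<Sum>a<N. 4 * len P / (M * (real a + 1))) + s \<le> 6 * harm N / real N * len P"
  proof -
    have h: "harm N = (\<Sum>a<N. 1 / (real a + 1))"
      by (rule harm_eq_sum)
    have "harm 1 \<le> (harm N :: real)" using assms(2) by (rule harm_mono)
    then have "1 \<le> (harm N :: real)" by (simp add: harm_def)
    have "s \<le> len P * (2 * harm N / M)"
      using \<open>1 \<le> harm N\<close> M len_pos[OF 0] by (intro order_trans[OF s(2)] mult_left_mono frac_le) (auto simp: M_def)
    moreover have "(\<Sum>a<N. 4 * len P / (M * (real a + 1))) = 4 * harm N / M * len P"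
      by (simp add: h sum_distrib_left sum_divide_distrib sum_distrib_right mult_ac)
    moreover have "4 * harm N / M * len P + len P * (2 * harm N / M) = 6 * harm N / M * len P"
      by (simp add: algebra_simps add_divide_distrib[symmetric])
    ultimately show ?thesis unfolding M_def by linarith
  qed
  finally show ?case by (simp add: A_def ennreal_leI)
next
  case (Suc n)
  have "(\<lambda>a. 6 * harm N / real N * len (child a P)) sums (6 * harm N / real N * len P)"
    by (intro sums_mult len_child_sums0 Suc.prems)
  then show ?case unfolding hit.simps
  proof (rule emeasure_UN_le[rotated 3])
    fix a
    have ok: "pair_ok (child a P)" using Suc.prems by (rule pair_ok_child)
    show "emeasure lborel (hit n N (child a P)) \<le> ennreal (6 * harm N / real N * len (child a P))"
      using ok by (rule Suc.IH)
    show "0 \<le> 6 * harm N / real N * len (child a P)"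
      using len_pos[OF ok] by (auto simp: harm_nonneg intro!: mult_nonneg_nonneg divide_nonneg_nonneg)
  qed (simp add: hit_sets)
qed

text \<open>Bounds the conditional expectation of the square root of a partial quotient plus one; the
  partial quotients themselves are not integrable.\<close>

definition growth_const :: real where
  "growth_const = (\<Sum>a. 2 * (real a + 1) powr (-3/2))"

lemma growth_sums: "(\<lambda>a. 2 * (real a + 1) powr (-3/2)) sums growth_const"
proof -
  have "summable (\<lambda>a. real a powr (-3/2))" by (subst summable_real_powr_iff) simp
  then have "summable (\<lambda>a. real (Suc a) powr (-3/2))" by (subst summable_Suc_iff)
  then have "summable (\<lambda>a. 2 * (real a + 1) powr (-3/2))" by (intro summable_mult) (simp add: add.commute)
  then show ?thesis unfolding growth_const_def by (rule summable_sums)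
qed

lemma growth_const_pos: "0 < growth_const"
  unfolding growth_const_def by (intro suminf_pos sums_summable[OF growth_sums]) simp

text \<open>Markov's inequality for the square root of the second coordinate. A step with digit
  \<open>a\<close> multiplies this coordinate by at most a+2 and has proportion at most
  2/((a+1)(a+2)), so it contributes at most 2 (a+1)^(-3/2), the summand of
  \<open>growth_const\<close>.\<close>

lemma emeasure_grow_le:
  assumes "pair_ok P" "0 < l"
  shows "emeasure lborel (grow n l P) \<le> ennreal (growth_const ^ n * sqrt (snd P $ 2 / l) * len P)"
  using assms(1)
proof (induction n arbitrary: P)
  case 0
  have "len P \<le> sqrt (snd P $ 2 / l) * len P" if "l < snd P $ 2"
    using that assms(2) len_pos[OF 0] by simp
  then show ?case using 0 by (simp add: emeasure_cyl ennreal_leI)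
next
  case (Suc n)
  define x y where "x = fst P $ 2" and "y = snd P $ 2"
  have xy: "0 \<le> x" "x \<le> y" "0 < y" using Suc.prems by (auto simp: pair_ok_def x_def y_def)
  define f where "f a = growth_const ^ n * sqrt (y / l) * len P * (2 * (real a + 1) powr (-3/2))" for a
  have "f sums (growth_const ^ n * sqrt (y / l) * len P * growth_const)"
    unfolding f_def by (intro sums_mult growth_sums)
  then have "emeasure lborel (\<Union>a. grow n l (child a P)) \<le> ennreal (growth_const ^ n * sqrt (y / l) * len P * growth_const)"
  proof (rule emeasure_UN_le[rotated 3])
    fix a
    have "snd (child a P) $ 2 \<le> (real a + 2) * y"
      using xy by (simp add: child_def x_def[symmetric] y_def[symmetric] algebra_simps)
    then have "sqrt (snd (child a P) $ 2 / l) \<le> sqrt ((real a + 2) * (y / l))"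
      using assms(2) by (simp add: divide_right_mono)
    then have 1: "sqrt (snd (child a P) $ 2 / l) \<le> sqrt (real a + 2) * sqrt (y / l)"
      by (simp only: real_sqrt_mult)
    have "sqrt (snd (child a P) $ 2 / l) * len (child a P)
        \<le> (sqrt (real a + 2) * sqrt (y / l)) * (2 * len P / ((real a + 1) * (real a + 2)))"
      using 1 len_child_bounds(2)[OF Suc.prems, of a] len_pos[OF pair_ok_child[OF Suc.prems], of a] xy assms(2)
      by (intro mult_mono) auto
    also have "\<dots> = sqrt (y / l) * len P * (2 * (1 / ((real a + 1) * sqrt (real a + 2))))"
    proof -
      define q where "q = sqrt (real a + 2)"
      have q: "0 < q" "real a + 2 = q * q" by (auto simp: q_def)
      have "q * sqrt (y / l) * (2 * len P / ((real a + 1) * (q * q)))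
          = sqrt (y / l) * len P * (2 * (1 / ((real a + 1) * q)))"
        using q(1) by (simp add: divide_simps)
      then show ?thesis unfolding q_def[symmetric] unfolding q(2) .
    qed
    also have "\<dots> \<le> sqrt (y / l) * len P * (2 * (real a + 1) powr (-3/2))"
    proof (intro mult_left_mono)
      have "(real a + 1) powr (-3/2) = 1 / ((real a + 1) powr (1 + 1/2))"
        by (simp add: powr_minus_divide[symmetric])
      also have "\<dots> = 1 / ((real a + 1) * sqrt (real a + 1))"
        by (subst powr_add) (simp add: powr_half_sqrt)
      finally have "(real a + 1) powr (-3/2) = 1 / ((real a + 1) * sqrt (real a + 1))" .
      then show "1 / ((real a + 1) * sqrt (real a + 2)) \<le> (real a + 1) powr (-3/2)"
        by (simp only:) (intro divide_left_mono mult_left_mono mult_pos_pos; simp)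
    qed (use xy assms(2) len_pos[OF Suc.prems] in auto)
    finally have "growth_const ^ n * sqrt (snd (child a P) $ 2 / l) * len (child a P) \<le> f a"
      using growth_const_pos by (simp add: f_def mult_left_mono mult.assoc)
    then show "emeasure lborel (grow n l (child a P)) \<le> ennreal (f a)"
      using Suc.IH[OF pair_ok_child[OF Suc.prems], of a] by (meson ennreal_leI order_trans)
    show "0 \<le> f a" using growth_const_pos xy assms(2) len_pos[OF Suc.prems] by (simp add: f_def)
  qed simp
  then show ?case by (simp add: y_def mult_ac)
qed

section \<open>Orbits of continued fraction steps\<close>

primrec orb :: "(nat \<Rightarrow> nat) \<Rightarrow> (real^2) \<times> (real^2) \<Rightarrow> nat \<Rightarrow> (real^2) \<times> (real^2)" where
  "orb d P 0 = P"
| "orb d P (Suc k) = child (d k) (orb d P k)"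

lemma orb_shift: "orb d P (Suc k) = orb (\<lambda>j. d (Suc j)) (child (d 0) P) k"
  by (induction k) auto

lemma pair_ok_orb: "pair_ok P \<Longrightarrow> pair_ok (orb d P k)"
  by (induction k) (auto intro: pair_ok_child)

lemma mem_bad:
  assumes "\<forall>k. t \<in> cyl (orb d P k)" "\<forall>j<n. d (2 * j + 1) < N j div Suc (d (2 * j))"
  shows "t \<in> bad n N P"
  using assms
proof (induction n arbitrary: d P N)
  case 0
  then show ?case using spec[OF 0(1), of 0] by simp
next
  case (Suc n)
  let ?d = "\<lambda>j. d (Suc (Suc j))" and ?P = "child (d 1) (child (d 0) P)"
  have "orb ?d ?P k = orb d P (Suc (Suc k))" for k
    by (simp only: orb_shift) simp
  then have "\<forall>k. t \<in> cyl (orb ?d ?P k)" using Suc.prems(1) by (simp del: orb.simps)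
  moreover have "\<forall>j<n. ?d (2 * j + 1) < N (Suc j) div Suc (?d (2 * j))"
  proof (intro allI impI)
    fix j assume "j < n"
    then show "?d (2 * j + 1) < N (Suc j) div Suc (?d (2 * j))"
      using Suc.prems(2)[rule_format, of "Suc j"] by simp
  qed
  ultimately have "t \<in> bad n (\<lambda>j. N (Suc j)) ?P" by (rule Suc.IH)
  moreover have "d 1 < N 0 div Suc (d 0)" using Suc.prems(2)[rule_format, of 0] by simp
  ultimately show ?case unfolding bad.simps by blast
qed

lemma mem_hit:
  assumes "\<forall>k. t \<in> cyl (orb d P k)" "N div Suc (d n) \<le> Suc (d (Suc n))"
  shows "t \<in> hit n N P"
  using assms
proof (induction n arbitrary: d P)
  case 0
  then show ?case using spec[OF 0(1), of 2] by (auto simp: numeral_2_eq_2)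
next
  case (Suc n)
  have "\<forall>k. t \<in> cyl (orb (\<lambda>j. d (Suc j)) (child (d 0) P) k)"
    using Suc.prems(1) unfolding orb_shift[symmetric] by blast
  then have "t \<in> hit n N (child (d 0) P)" using Suc.prems(2) by (rule Suc.IH)
  then show ?case unfolding hit.simps by blast
qed

lemma mem_grow:
  assumes "\<forall>k. t \<in> cyl (orb d P k)" "l < snd (orb d P n) $ 2"
  shows "t \<in> grow n l P"
  using assms
proof (induction n arbitrary: d P)
  case 0
  then show ?case using spec[OF 0(1), of 0] by simp
next
  case (Suc n)
  have "\<forall>k. t \<in> cyl (orb (\<lambda>j. d (Suc j)) (child (d 0) P) k)"
    using Suc.prems(1) unfolding orb_shift[symmetric] by blast
  moreover have "l < snd (orb (\<lambda>j. d (Suc j)) (child (d 0) P) n) $ 2"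
    using Suc.prems(2) unfolding orb_shift .
  ultimately have "t \<in> grow n l (child (d 0) P)" by (rule Suc.IH)
  then show ?case unfolding grow.simps by blast
qed

text \<open>A relation between t and digit sequences rather than a digit function of t, so that
  almost-everywhere statements can quantify over all \<open>d\<close> without a measurability
  question.\<close>

definition orbit :: "real \<Rightarrow> (nat \<Rightarrow> nat) \<Rightarrow> (real^2) \<times> (real^2) \<Rightarrow> bool" where
  "orbit t d P \<longleftrightarrow> (\<forall>k. t \<in> cyl (orb d P k))"

lemma borel_cantelli_bound:
  assumes "\<And>k::nat. A k \<in> sets M" "\<And>k. emeasure M (A k) \<le> ennreal (f k)" "\<And>k. 0 \<le> f k" "summable f"
  shows "AE x in M. \<forall>\<^sub>F k in sequentially. x \<notin> A k"
proof -
  have "emeasure M (A k) < \<infinity>" for k using assms(2)[of k] by (rule le_less_trans) simp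
  moreover have "measure M (A k) \<le> f k" for k
    using enn2real_mono[OF assms(2)[of k]] assms(3)[of k] by (simp add: measure_def)
  then have "summable (\<lambda>k. measure M (A k))"
    by (intro summable_comparison_test[OF _ assms(4)]) auto
  ultimately have "AE x in M. \<forall>\<^sub>F k in sequentially. x \<in> space M - A k"
    by (intro borel_cantelli_AE1 assms(1))
  then show ?thesis by eventually_elim (auto elim: eventually_mono)
qed

lemma AE_eventually_not_hit:
  assumes "pair_ok P" "\<And>k. 1 \<le> N k" "summable (\<lambda>k. harm (N k) / real (N k) :: real)"
  shows "AE t in lborel. \<forall>d. orbit t d P \<longrightarrow> (\<forall>\<^sub>F k in sequentially. \<not> N k div Suc (d k) \<le> Suc (d (Suc k)))"
proof -
  have "AE t in lborel. \<forall>\<^sub>F k in sequentially. t \<notin> hit k (N k) P"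
  proof (rule borel_cantelli_bound)
    show "emeasure lborel (hit k (N k) P) \<le> ennreal (6 * harm (N k) / real (N k) * len P)" for k
      by (intro emeasure_hit_le assms)
    show "0 \<le> 6 * harm (N k) / real (N k) * len P" for k
      using len_pos[OF assms(1)] by (auto simp: harm_nonneg intro!: mult_nonneg_nonneg divide_nonneg_nonneg)
    show "summable (\<lambda>k. 6 * harm (N k) / real (N k) * len P)"
      using summable_mult[OF summable_mult2[OF assms(3), of "len P"], of 6] by (simp add: mult_ac)
  qed (simp add: hit_sets)
  then show ?thesis
  proof eventually_elim
    case (elim t)
    show ?case
    proof (intro allI impI)
      fix d assume "orbit t d P"
      with elim show "\<forall>\<^sub>F k in sequentially. \<not> N k div Suc (d k) \<le> Suc (d (Suc k))"
        by (auto elim!: eventually_mono dest: mem_hit simp: orbit_def)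
    qed
  qed
qed

text \<open>Chosen so that exp (\<open>growth_rate\<close> k) is the square of (2
  \<open>growth_const\<close>)^k; the bound of \<open>emeasure_grow_le\<close> then decays like
  2^(-k).\<close>

definition growth_rate :: real where
  "growth_rate = 2 * ln (2 * growth_const)"

lemma AE_eventually_growth:
  assumes "pair_ok P"
  shows "AE t in lborel. \<forall>d. orbit t d P \<longrightarrow>
    (\<forall>\<^sub>F k in sequentially. snd (orb d P k) $ 2 \<le> exp (growth_rate * real k))"
proof -
  define l where "l k = exp (growth_rate * real k)" for k
  have "AE t in lborel. \<forall>\<^sub>F k in sequentially. t \<notin> grow k (l k) P"
  proof (rule borel_cantelli_bound)
    have s: "sqrt (l k) = (2 * growth_const) ^ k" for k
    proof -
      have "l k = (exp (ln (2 * growth_const) * real k)) ^ 2"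
        unfolding exp_double[symmetric] l_def growth_rate_def by (simp only: mult.assoc)
      also have "exp (ln (2 * growth_const) * real k) = (2 * growth_const) ^ k"
        using growth_const_pos exp_of_nat_mult[of k "ln (2 * growth_const)"] by (simp add: mult.commute)
      finally show ?thesis using growth_const_pos by simp
    qed
    have "growth_const ^ k * sqrt (snd P $ 2 / l k) * len P = sqrt (snd P $ 2) * len P * (1/2) ^ k" for k
      using growth_const_pos by (simp add: real_sqrt_divide s field_simps)
    then show "emeasure lborel (grow k (l k) P) \<le> ennreal (sqrt (snd P $ 2) * len P * (1/2) ^ k)" for k
      using emeasure_grow_le[OF assms, of "l k" k] by (simp only: l_def exp_gt_zero)
    show "0 \<le> sqrt (snd P $ 2) * len P * (1/2) ^ k" for k
      using assms len_pos[OF assms] by (simp add: pair_ok_def)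
    show "summable (\<lambda>k. sqrt (snd P $ 2) * len P * (1/2) ^ k)"
      by (intro summable_mult summable_geometric) simp
  qed (simp add: grow_sets)
  then show ?thesis
  proof eventually_elim
    case (elim t)
    show ?case
    proof (intro allI impI)
      fix d assume o: "orbit t d P"
      from elim show "\<forall>\<^sub>F k in sequentially. snd (orb d P k) $ 2 \<le> exp (growth_rate * real k)"
      proof eventually_elim
        case (elim k)
        with mem_grow[of t d P "l k" k] o show ?case by (force simp: orbit_def l_def)
      qed
    qed
  qed
qed

text \<open>If all pairs of digits from the m-th on fail, the orbit restarted after 2m digits lies
  in every \<open>bad\<close> set of the shifted thresholds. A restarting pair is determined by a
  finite list of digits, so countably many null sets cover this.\<close>

lemma AE_infinitely_good:
  assumes "pair_ok P" "\<And>j. 1 \<le> N j" "\<not> summable (\<lambda>j. harm (N j) / real (N j) :: real)"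
  shows "AE t in lborel. \<forall>d. orbit t d P \<longrightarrow> (\<exists>\<^sub>F j in sequentially. N j div Suc (d (2 * j)) \<le> d (2 * j + 1))"
proof -
  define Q where "Q = {orb d P k |d k. True}"
  have "Q \<subseteq> (\<Union>ds. {fold child ds P})"
  proof
    fix q assume "q \<in> Q"
    then obtain d k where q: "q = orb d P k" by (auto simp: Q_def)
    have "orb d P k = fold child (map d [0..<k]) P" by (induction k) auto
    with q show "q \<in> (\<Union>ds. {fold child ds P})" by blast
  qed
  then have countQ: "countable Q" by (rule countable_subset) simp
  have okQ: "pair_ok R" if "R \<in> Q" for R using that pair_ok_orb[OF assms(1)] by (auto simp: Q_def)
  have "AE t in lborel. \<forall>R\<in>Q. \<forall>m. t \<notin> (\<Inter>n. bad n (\<lambda>j. N (j + m)) R)"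
    unfolding AE_ball_countable[OF countQ] AE_all_countable
  proof (intro ballI allI AE_not_in null_bad)
    show "\<not> summable (\<lambda>j. harm (N (j + m)) / real (N (j + m)) :: real)" for m
      using assms(3) by (subst summable_iff_shift)
  qed (use okQ assms(2) in auto)
  then show ?thesis
  proof eventually_elim
    case (elim t)
    show ?case
    proof (intro allI impI)
      fix d assume o: "orbit t d P"
      show "\<exists>\<^sub>F j in sequentially. N j div Suc (d (2 * j)) \<le> d (2 * j + 1)"
      proof (rule ccontr)
        assume "\<not> ?thesis"
        then obtain m where "\<forall>j\<ge>m. d (2 * j + 1) < N j div Suc (d (2 * j))"
          unfolding not_frequently eventually_sequentially not_le by blast
        then have m: "d (2 * j + 1) < N j div Suc (d (2 * j))" if "j \<ge> m" for j
          using that by blast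
        define R where "R = orb d P (2 * m)"
        define d' where "d' k = d (k + 2 * m)" for k
        have sh: "orb d' R k = orb d P (k + 2 * m)" for k
          by (induction k) (auto simp: R_def d'_def)
        have "t \<in> bad n (\<lambda>j. N (j + m)) R" for n
        proof (rule mem_bad)
          show "\<forall>k. t \<in> cyl (orb d' R k)" using o by (simp add: sh orbit_def)
          show "\<forall>j<n. d' (2 * j + 1) < N (j + m) div Suc (d' (2 * j))"
          proof (intro allI impI)
            fix j
            show "d' (2 * j + 1) < N (j + m) div Suc (d' (2 * j))"
              using m[of "j + m"] by (simp add: d'_def algebra_simps)
          qed
        qed
        moreover have "R \<in> Q" by (auto simp: Q_def R_def)
        ultimately show False using elim by blast
      qed
    qed
  qed
qed

section \<open>Unimodular lattices\<close>

lemma vec2_eq_iff: "(v :: real^2) = w \<longleftrightarrow> v $ 1 = w $ 1 \<and> v $ 2 = w $ 2"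
  by (simp add: vec_eq_iff forall_2)

lemma XlatE:
  assumes "L \<in> Xlat"
  obtains e f where "cross2 e f = 1" "L = {of_int m *\<^sub>R e + of_int n *\<^sub>R f | m n. True}"
proof -
  obtain g where g: "det g = 1" "L = (\<lambda>z. g *v z) ` Zvec"
    using assms by (auto simp: Xlat_def SL2_def lat_def)
  define e :: "real^2" where "e = (\<chi> i. g $ i $ 1)"
  define f :: "real^2" where "f = (\<chi> i. g $ i $ 2)"
  have "cross2 e f = 1" using g(1) by (simp add: cross2_def e_def f_def det_2 mult.commute)
  moreover have gz: "g *v z = z $ 1 *\<^sub>R e + z $ 2 *\<^sub>R f" for z
    by (simp add: vec2_eq_iff matrix_vector_mult_def sum_2 e_def f_def)
  have "L = {of_int m *\<^sub>R e + of_int n *\<^sub>R f | m n. True}"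
  proof safe
    fix x assume "x \<in> L"
    then obtain z where z: "z \<in> Zvec" "x = z $ 1 *\<^sub>R e + z $ 2 *\<^sub>R f" using g(2) gz by auto
    then obtain m n where "z $ 1 = of_int m" "z $ 2 = of_int n" unfolding Zvec_def by (metis (mono_tags, lifting) Ints_cases mem_Collect_eq)
    with z(2) show "\<exists>m n. x = of_int m *\<^sub>R e + of_int n *\<^sub>R f \<and> True" by auto
  next
    fix m n
    have "(vector [of_int m, of_int n] :: real^2) \<in> Zvec" by (simp add: Zvec_def forall_2)
    moreover have "of_int m *\<^sub>R e + of_int n *\<^sub>R f = g *v vector [of_int m, of_int n]"
      by (simp add: gz)
    ultimately show "of_int m *\<^sub>R e + of_int n *\<^sub>R f \<in> L" using g(2) by blast
  qed
  ultimately show ?thesis using that by blast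
qed

lemma Xlat_add_scale:
  assumes "L \<in> Xlat" "v \<in> L" "w \<in> L" shows "v + of_int a *\<^sub>R w \<in> L"
proof -
  obtain e f where "cross2 e f = 1" and L: "L = {of_int m *\<^sub>R e + of_int n *\<^sub>R f | m n. True}"
    by (rule XlatE[OF assms(1)])
  obtain m n m' n' where "v = of_int m *\<^sub>R e + of_int n *\<^sub>R f" "w = of_int m' *\<^sub>R e + of_int n' *\<^sub>R f"
    using assms(2,3) L by auto
  then have "v + of_int a *\<^sub>R w = of_int (m + a * m') *\<^sub>R e + of_int (n + a * n') *\<^sub>R f"
    by (simp add: algebra_simps)
  then show ?thesis unfolding L by blast
qed

lemma Xlat_zero: "L \<in> Xlat \<Longrightarrow> 0 \<in> L"
  by (erule XlatE) (auto intro!: exI[of _ 0])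

lemma Xlat_add: "L \<in> Xlat \<Longrightarrow> v \<in> L \<Longrightarrow> w \<in> L \<Longrightarrow> v + w \<in> L"
  using Xlat_add_scale[of L v w 1] by simp

lemma Xlat_diff: "L \<in> Xlat \<Longrightarrow> v \<in> L \<Longrightarrow> w \<in> L \<Longrightarrow> v - w \<in> L"
  using Xlat_add_scale[of L v w "-1"] by simp

lemma Xlat_minus: "L \<in> Xlat \<Longrightarrow> w \<in> L \<Longrightarrow> - w \<in> L"
  using Xlat_add_scale[of L 0 w "-1"] Xlat_zero[of L] by simp

lemma cross2_Ints:
  assumes "L \<in> Xlat" "v \<in> L" "w \<in> L" shows "cross2 v w \<in> \<int>"
proof -
  obtain e f where ef: "cross2 e f = 1" and L: "L = {of_int m *\<^sub>R e + of_int n *\<^sub>R f | m n. True}"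
    by (rule XlatE[OF assms(1)])
  obtain m n m' n' where "v = of_int m *\<^sub>R e + of_int n *\<^sub>R f" "w = of_int m' *\<^sub>R e + of_int n' *\<^sub>R f"
    using assms(2,3) L by auto
  then have "cross2 v w = (of_int m * of_int n' - of_int n * of_int m') * cross2 e f"
    by (simp add: cross2_def algebra_simps)
  then show ?thesis by (simp add: ef)
qed

lemma cramer2:
  assumes "cross2 v w \<noteq> 0"
  shows "z = (cross2 z w / cross2 v w) *\<^sub>R v + (cross2 v z / cross2 v w) *\<^sub>R w"
proof -
  have "cross2 v w *\<^sub>R z = cross2 z w *\<^sub>R v + cross2 v z *\<^sub>R w"
    by (simp add: vec2_eq_iff cross2_def algebra_simps)
  then have "(1 / cross2 v w) *\<^sub>R (cross2 v w *\<^sub>R z) = (1 / cross2 v w) *\<^sub>R (cross2 z w *\<^sub>R v + cross2 v z *\<^sub>R w)"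
    by simp
  then show ?thesis using assms by (simp add: scaleR_add_right)
qed

text \<open>The coefficients given by Cramer's rule are quotients of integer determinants by a
  determinant 1 or -1.\<close>

lemma Xlat_basis:
  assumes "L \<in> Xlat" "v \<in> L" "w \<in> L" "z \<in> L" "\<bar>cross2 v w\<bar> = 1"
  obtains m n where "z = of_int m *\<^sub>R v + of_int n *\<^sub>R w"
proof -
  have c: "cross2 v w = 1 \<or> cross2 v w = -1" using assms(5) by linarith
  then have "cross2 z w / cross2 v w \<in> \<int>" "cross2 v z / cross2 v w \<in> \<int>"
    using cross2_Ints[OF assms(1)] assms(2-4) by auto
  then obtain m n where "cross2 z w / cross2 v w = of_int m" "cross2 v z / cross2 v w = of_int n"
    by (auto simp: Ints_def)
  then show ?thesis using that cramer2[of v w z] c by auto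
qed

lemma Xlat_countable: "L \<in> Xlat \<Longrightarrow> countable L"
proof (erule XlatE)
  fix e f assume "L = {of_int m *\<^sub>R e + of_int n *\<^sub>R f | m n. True}"
  then have "L = range (\<lambda>(m::int, n::int). of_int m *\<^sub>R e + of_int n *\<^sub>R f)" by auto
  then show "countable L" by simp
qed

text \<open>Discreteness in the coordinates (\<open>lform t z\<close>, \<open>z $ 2\<close>): this
  change of coordinates preserves determinants, so Cramer's rule bounds the two integer coefficients
  of z.\<close>

lemma Xlat_finite:
  assumes "L \<in> Xlat" shows "finite {z \<in> L. \<bar>lform t z\<bar> \<le> C \<and> \<bar>z $ 2\<bar> \<le> C}"
proof -
  obtain e f where ef: "cross2 e f = 1" and L: "L = {of_int m *\<^sub>R e + of_int n *\<^sub>R f | m n. True}"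
    by (rule XlatE[OF assms(1)])
  define B where "B = C * (\<bar>f $ 2\<bar> + \<bar>lform t f\<bar> + \<bar>e $ 2\<bar> + \<bar>lform t e\<bar>)"
  define I where "I = {- \<lceil>B\<rceil>..\<lceil>B\<rceil>}"
  have "{z \<in> L. \<bar>lform t z\<bar> \<le> C \<and> \<bar>z $ 2\<bar> \<le> C} \<subseteq> (\<lambda>(m, n). of_int m *\<^sub>R e + of_int n *\<^sub>R f) ` (I \<times> I)"
  proof safe
    fix z assume z: "z \<in> L" "\<bar>lform t z\<bar> \<le> C" "\<bar>z $ 2\<bar> \<le> C"
    then obtain m n where mn: "z = of_int m *\<^sub>R e + of_int n *\<^sub>R f" using L by auto
    have "\<bar>lform t z * f $ 2\<bar> \<le> C * \<bar>f $ 2\<bar>" "\<bar>z $ 2 * lform t f\<bar> \<le> C * \<bar>lform t f\<bar>"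
      "\<bar>lform t z * e $ 2\<bar> \<le> C * \<bar>e $ 2\<bar>" "\<bar>z $ 2 * lform t e\<bar> \<le> C * \<bar>lform t e\<bar>"
      using z by (simp_all only: abs_mult mult_right_mono abs_ge_zero)
    moreover have "of_int m * cross2 e f = lform t z * f $ 2 - z $ 2 * lform t f"
      "of_int n * cross2 e f = z $ 2 * lform t e - lform t z * e $ 2"
      by (simp_all add: mn cross2_def lform_def algebra_simps)
    moreover have "0 \<le> C * \<bar>f $ 2\<bar>" "0 \<le> C * \<bar>lform t f\<bar>" "0 \<le> C * \<bar>e $ 2\<bar>" "0 \<le> C * \<bar>lform t e\<bar>"
      using z by auto
    ultimately have "\<bar>of_int m\<bar> \<le> B" "\<bar>of_int n\<bar> \<le> B"
      unfolding B_def ef distrib_left by (simp only: mult_1_right, linarith)+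
    then have "m \<in> I" "n \<in> I" unfolding I_def by (auto; linarith)+
    then show "z \<in> (\<lambda>(m, n). of_int m *\<^sub>R e + of_int n *\<^sub>R f) ` (I \<times> I)" using mn by auto
  qed
  then show ?thesis by (rule finite_subset) (simp add: I_def)
qed

text \<open>No non-zero vector of the translate by u_t lies on the vertical axis, so the continued
  fraction algorithm never stops.\<close>

definition generic :: "real \<Rightarrow> (real^2) set \<Rightarrow> bool" where
  "generic t L \<longleftrightarrow> (\<forall>z\<in>L. z \<noteq> 0 \<longrightarrow> lform t z \<noteq> 0)"

lemma AE_generic: "L \<in> Xlat \<Longrightarrow> AE t in lborel. generic t L"
proof -
  assume L: "L \<in> Xlat"
  have "AE t in lborel. z \<noteq> 0 \<longrightarrow> lform t z \<noteq> 0" for z :: "real^2"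
  proof (cases "z $ 2 = 0")
    case True
    then have "z \<noteq> 0 \<longrightarrow> lform t z \<noteq> 0" for t by (simp add: lform_def vec2_eq_iff)
    then show ?thesis by simp
  next
    case False
    have ne: "lform t z \<noteq> 0" if "t \<noteq> - z $ 1 / z $ 2" for t
      using that False by (simp add: lform_def field_simps add_eq_0_iff)
    then show ?thesis using AE_lborel_singleton[of "- z $ 1 / z $ 2"]
      by eventually_elim (use ne in blast)
  qed
  then show ?thesis unfolding generic_def by (subst AE_ball_countable[OF Xlat_countable[OF L]]) simp
qed

text \<open>It suffices to find a basis with positive forms and second coordinates of weakly
  opposite signs, and then to negate one vector. Among all bases with positive forms one of minimal
  \<open>size\<close> is taken; it exists since \<open>size\<close> bounds all four coordinates,
  leaving finitely many competitors below a given one.\<close>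

lemma generic_basis_opposite:
  assumes "L \<in> Xlat" "generic t L"
  obtains v w where "v \<in> L" "w \<in> L" "\<bar>cross2 v w\<bar> = 1" "lform t v * lform t w < 0" "0 \<le> v $ 2" "0 \<le> w $ 2"
proof -
  note result = that
  define S where "S = {(e, f). e \<in> L \<and> f \<in> L \<and> \<bar>cross2 e f\<bar> = 1 \<and> 0 < lform t e \<and> 0 < lform t f}"
  have nz: "z \<in> L \<Longrightarrow> z \<noteq> 0 \<Longrightarrow> lform t z \<noteq> 0" for z using assms(2) by (auto simp: generic_def)
  have c0: "cross2 0 z = 0" "cross2 z 0 = 0" for z by (auto simp: cross2_def)
  have cneg: "cross2 (- a) b = - cross2 a b" "cross2 a (- b) = - cross2 a b" for a b by (auto simp: cross2_def)
  define size where "size p = lform t (fst p) + lform t (snd p) + \<bar>fst p $ 2\<bar> + \<bar>snd p $ 2\<bar>" for p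
  have "S \<noteq> {}"
  proof -
    obtain e f where ef: "cross2 e f = 1" "L = {of_int m *\<^sub>R e + of_int n *\<^sub>R f | m n. True}"
      by (rule XlatE[OF assms(1)])
    have "e = of_int 1 *\<^sub>R e + of_int 0 *\<^sub>R f" "f = of_int 0 *\<^sub>R e + of_int 1 *\<^sub>R f" by simp_all
    then have L: "e \<in> L" "f \<in> L" unfolding ef(2) by blast+
    define e' where "e' = (if 0 < lform t e then e else - e)"
    define f' where "f' = (if 0 < lform t f then f else - f)"
    have "e \<noteq> 0" "f \<noteq> 0" using ef(1) c0 by auto
    then have "0 < lform t e'" "0 < lform t f'" using nz L by (auto simp: e'_def f'_def not_less order_less_le)
    moreover have "\<bar>cross2 e' f'\<bar> = 1" using ef(1) by (simp add: e'_def f'_def cneg)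
    ultimately have "(e', f') \<in> S" using L assms(1) by (auto simp: S_def e'_def f'_def Xlat_minus)
    then show ?thesis by blast
  qed
  then obtain p0 where p0: "p0 \<in> S" by blast
  define S' where "S' = {p \<in> S. size p \<le> size p0}"
  have "S' \<subseteq> {z \<in> L. \<bar>lform t z\<bar> \<le> size p0 \<and> \<bar>z $ 2\<bar> \<le> size p0} \<times> {z \<in> L. \<bar>lform t z\<bar> \<le> size p0 \<and> \<bar>z $ 2\<bar> \<le> size p0}"
    by (auto simp: S'_def S_def size_def)
  then have "finite S'" by (rule finite_subset) (intro finite_cartesian_product Xlat_finite assms)
  moreover have "p0 \<in> S'" using p0 by (simp add: S'_def)
  then have "S' \<noteq> {}" by blast
  ultimately obtain p where p: "p \<in> S'" "\<forall>q\<in>S'. size p \<le> size q"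
    using arg_min_if_finite[of S' size] by (meson leI)
  then have min: "size p \<le> size q" if "q \<in> S" for q
  proof (cases "size q \<le> size p0")
    case True
    then have "q \<in> S'" using that by (simp add: S'_def)
    then show ?thesis using p(2) by blast
  next
    case False
    then show ?thesis using p(1) by (auto simp: S'_def)
  qed
  obtain e f where pe: "p = (e, f)" by fastforce
  have ef: "e \<in> L" "f \<in> L" "\<bar>cross2 e f\<bar> = 1" "0 < lform t e" "0 < lform t f"
    using p(1) by (auto simp: S'_def S_def pe)
  have good: thesis if "a \<in> L" "b \<in> L" "\<bar>cross2 a b\<bar> = 1" "0 < lform t a" "0 < lform t b" "a $ 2 * b $ 2 \<le> 0" for a b
  proof (cases "0 \<le> a $ 2 \<and> b $ 2 \<le> 0")
    case True
    then show ?thesis using that(1-5) result[of a "- b"] assms(1)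
      by (simp add: Xlat_minus cneg)
  next
    case False
    then have "a $ 2 \<le> 0 \<and> 0 \<le> b $ 2" using that(6) by (auto simp: mult_le_0_iff)
    then show ?thesis using that(1-5) result[of "- a" b] assms(1)
      by (simp add: Xlat_minus cneg)
  qed
  \<comment> \<open>If both second coordinates of a minimal basis had the same sign, subtracting one vector
    from the other would either decrease the size or make the signs opposite.\<close>
  have step: thesis if "a \<in> L" "b \<in> L" "\<bar>cross2 a b\<bar> = 1" "0 < lform t b" "lform t b < lform t a"
    and m: "size (a, b) \<le> size (a - b, b)" for a b
  proof (cases "a $ 2 * b $ 2 \<le> 0")
    case True
    then show ?thesis using that by (intro good[of a b]) auto
  next
    case False
    have "cross2 (a - b) b = cross2 a b" by (simp add: cross2_def algebra_simps)
    moreover have "(a - b) $ 2 * b $ 2 \<le> 0"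
      using False m that(4) by (auto simp: size_def mult_le_0_iff not_le zero_less_mult_iff)
    ultimately show ?thesis using that assms(1) by (intro good[of "a - b" b]) (auto simp: Xlat_diff)
  qed
  have "e - f \<noteq> 0" using ef(3) by (auto simp: cross2_def)
  then have "lform t e \<noteq> lform t f" using nz[of "e - f"] ef assms(1) by (auto simp: Xlat_diff)
  then consider "lform t f < lform t e" | "lform t e < lform t f" by linarith
  then show ?thesis
  proof cases
    case 1
    have "cross2 (e - f) f = cross2 e f" by (simp add: cross2_def algebra_simps)
    then have "(e - f, f) \<in> S" using ef 1 assms(1) by (auto simp: S_def Xlat_diff)
    then show ?thesis using ef 1 min pe by (intro step[of e f]) auto
  next
    case 2
    have "cross2 e (f - e) = cross2 e f" by (simp add: cross2_def algebra_simps)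
    then have "(e, f - e) \<in> S" using ef 2 assms(1) by (auto simp: S_def Xlat_diff)
    moreover have "\<bar>cross2 f e\<bar> = 1" using ef(3) by (simp add: cross2_def abs_minus_commute mult.commute)
    ultimately show ?thesis using ef 2 min[of "(e, f - e)"] pe by (intro step[of f e]) (auto simp: size_def)
  qed
qed

text \<open>The forms of v + n w change sign as n passes \<open>\<rho>\<close> > 1, so the partial
  quotient is the floor of \<open>\<rho>\<close>. Genericity excludes that \<open>\<rho>\<close> is
  an integer, which makes the sign change strict.\<close>

lemma generic_child:
  assumes "L \<in> Xlat" "generic t L" "v \<in> L" "w \<in> L" "v \<noteq> 0" "cross2 v w \<noteq> 0"
    and "lform t w * (lform t v + lform t w) < 0"
  obtains a where "t \<in> cyl (child a (v, w))"
proof -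
  have w: "lform t w \<noteq> 0" using assms(7) by auto
  define \<rho> where "\<rho> = - lform t v / lform t w"
  have v: "lform t v = - \<rho> * lform t w" using w by (simp add: \<rho>_def)
  have "(lform t w)\<^sup>2 * (1 - \<rho>) < 0" using assms(7) by (simp add: v power2_eq_square algebra_simps)
  then have "1 < \<rho>" by (simp add: mult_less_0_iff)
  define a where "a = nat \<lfloor>\<rho>\<rfloor> - 1"
  have a: "real a + 1 = of_int \<lfloor>\<rho>\<rfloor>" using \<open>1 < \<rho>\<close> by (simp add: a_def of_nat_diff le_nat_iff)
  have "v + of_int \<lfloor>\<rho>\<rfloor> *\<^sub>R w \<in> L" using assms by (intro Xlat_add_scale)
  moreover have "v + of_int \<lfloor>\<rho>\<rfloor> *\<^sub>R w \<noteq> 0"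
  proof
    assume "v + of_int \<lfloor>\<rho>\<rfloor> *\<^sub>R w = 0"
    then have "v = - (of_int \<lfloor>\<rho>\<rfloor> *\<^sub>R w)" by (simp add: eq_neg_iff_add_eq_0)
    then have "cross2 v w = 0" by (simp add: cross2_def)
    with assms(6) show False by simp
  qed
  ultimately have "lform t (v + of_int \<lfloor>\<rho>\<rfloor> *\<^sub>R w) \<noteq> 0" using assms(2) by (auto simp: generic_def)
  then have "of_int \<lfloor>\<rho>\<rfloor> \<noteq> \<rho>" using w v by (auto simp: algebra_simps)
  then have "(real a + 1 - \<rho>) * (real a + 2 - \<rho>) < 0"
    using a of_int_floor_le[of \<rho>] floor_correct[of \<rho>] by (intro mult_neg_pos) linarith+
  moreover have "lform t (v + real (Suc a) *\<^sub>R w) * lform t (w + (v + real (Suc a) *\<^sub>R w))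
      = (lform t w)\<^sup>2 * ((real a + 1 - \<rho>) * (real a + 2 - \<rho>))"
    unfolding lform_add lform_scaleR v by (simp add: power2_eq_square algebra_simps)
  moreover have "0 < (lform t w)\<^sup>2" using w by simp
  ultimately have "t \<in> cyl (child a (v, w))"
    unfolding cyl_def child_def fst_conv snd_conv mem_Collect_eq by (simp only: mult_pos_neg)
  then show ?thesis by (rule that)
qed

text \<open>A basis with opposite forms, ordered by the size of the forms, may still have its second
  coordinates in the wrong order for \<open>pair_ok\<close>. One step of the algorithm orders them,
  so the start is a child of that basis.\<close>

lemma generic_start:
  assumes "L \<in> Xlat" "generic t L"
  obtains P where "pair_ok P" "fst P \<in> L" "snd P \<in> L" "t \<in> cyl P"
proof -
  note result = that
  have step: thesis if vw: "v \<in> L" "w \<in> L" "\<bar>cross2 v w\<bar> = 1" "lform t v * lform t w < 0" "0 \<le> v $ 2" "0 \<le> w $ 2"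
    and lt: "\<bar>lform t w\<bar> < \<bar>lform t v\<bar>" for v w
  proof -
    have "lform t w * (lform t v + lform t w) < 0"
      using vw(4) lt by (auto simp: mult_less_0_iff abs_if split: if_splits)
    moreover have "v \<noteq> 0" "cross2 v w \<noteq> 0" using vw by (auto simp: cross2_def)
    ultimately obtain a where a: "t \<in> cyl (child a (v, w))"
      using generic_child[OF assms vw(1,2)] by blast
    have y: "0 < v $ 2 + w $ 2" using vw(3,5,6) by (auto simp: cross2_def order_less_le add_nonneg_eq_0_iff)
    have "pair_ok (child a (v, w))"
      unfolding pair_ok_def
    proof (intro conjI)
      have "cross2 w (v + real (Suc a) *\<^sub>R w) = - cross2 v w" by (simp add: cross2_def algebra_simps)
      then show "\<bar>cross2 (fst (child a (v, w))) (snd (child a (v, w)))\<bar> = 1" using vw(3) by (simp add: child_def)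
      have "0 \<le> real a * w $ 2" using vw(6) by simp
      then show "0 < snd (child a (v, w)) $ 2" using y by (simp add: child_def distrib_right)
    qed (use vw(5,6) in \<open>auto simp: child_def distrib_right\<close>)
    moreover have "snd (child a (v, w)) \<in> L"
      using Xlat_add_scale[OF assms(1) vw(1,2), of "int (Suc a)"] by (simp add: child_def)
    ultimately show thesis using a vw(2) by (intro result[of "child a (v, w)"]) (auto simp: child_def)
  qed
  obtain v w where vw: "v \<in> L" "w \<in> L" "\<bar>cross2 v w\<bar> = 1" "lform t v * lform t w < 0" "0 \<le> v $ 2" "0 \<le> w $ 2"
    by (rule generic_basis_opposite[OF assms])
  have "v + w \<noteq> 0"
  proof
    assume "v + w = 0"
    then have "v = - w" by (simp add: eq_neg_iff_add_eq_0)
    then show False using vw(3) by (simp add: cross2_def)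
  qed
  then have "lform t v + lform t w \<noteq> 0"
    using assms vw by (auto simp: generic_def Xlat_add simp flip: lform_add)
  then have "\<bar>lform t v\<bar> \<noteq> \<bar>lform t w\<bar>" using vw(4) by (auto simp: abs_if mult_less_0_iff split: if_splits)
  then consider "\<bar>lform t w\<bar> < \<bar>lform t v\<bar>" | "\<bar>lform t v\<bar> < \<bar>lform t w\<bar>" by linarith
  then show ?thesis
  proof cases
    case 1 then show ?thesis using vw by (intro step[of v w])
  next
    case 2
    moreover have "\<bar>cross2 w v\<bar> = 1" using vw(3) by (simp add: cross2_def abs_minus_commute mult.commute)
    ultimately show ?thesis using vw by (intro step[of w v]) (auto simp: mult.commute)
  qed
qed

lemma generic_orbit:
  assumes L: "L \<in> Xlat" "generic t L" and P: "pair_ok P" "fst P \<in> L" "snd P \<in> L" "t \<in> cyl P"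
  obtains d where "orbit t d P" "\<forall>k. fst (orb d P k) \<in> L"
proof -
  define good where "good R \<longleftrightarrow> pair_ok R \<and> fst R \<in> L \<and> snd R \<in> L \<and> t \<in> cyl R" for R
  have ex: "\<exists>a. t \<in> cyl (child a R)" if "good R" for R
  proof -
    have "fst R \<noteq> 0" "cross2 (fst R) (snd R) \<noteq> 0"
      "lform t (snd R) * (lform t (fst R) + lform t (snd R)) < 0" "fst R \<in> L" "snd R \<in> L"
      using that by (auto simp: good_def pair_ok_def cross2_def cyl_def)
    then obtain a where "t \<in> cyl (child a (fst R, snd R))"
      using generic_child[OF L] by blast
    then show ?thesis by auto
  qed
  define D where "D R = (SOME a. t \<in> cyl (child a R))" for R
  have D: "good (child (D R) R)" if "good R" for R
  proof -
    have "t \<in> cyl (child (D R) R)" unfolding D_def using someI_ex[OF ex[OF that]] .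
    moreover have "snd (child (D R) R) \<in> L"
      using that Xlat_add_scale[OF L(1), of "fst R" "snd R" "int (Suc (D R))"]
      by (simp add: child_def good_def)
    ultimately show ?thesis using that pair_ok_child by (auto simp: good_def child_def)
  qed
  define d where "d k = D (((\<lambda>R. child (D R) R) ^^ k) P)" for k
  have orb: "orb d P k = ((\<lambda>R. child (D R) R) ^^ k) P" for k
    by (induction k) (auto simp: d_def)
  have "good (orb d P k)" for k
    unfolding orb by (induction k) (use P D in \<open>auto simp: good_def[of P]\<close>)
  then show ?thesis using that[of d] by (auto simp: good_def orbit_def)
qed

section \<open>Empty boxes and digits\<close>

abbreviation yc :: "(nat \<Rightarrow> nat) \<Rightarrow> (real^2) \<times> (real^2) \<Rightarrow> nat \<Rightarrow> real" where
  "yc d P k \<equiv> fst (orb d P k) $ 2"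

abbreviation xc :: "real \<Rightarrow> (nat \<Rightarrow> nat) \<Rightarrow> (real^2) \<times> (real^2) \<Rightarrow> nat \<Rightarrow> real" where
  "xc t d P k \<equiv> \<bar>lform t (fst (orb d P k))\<bar>"

text \<open>The lattice \<open>a\<^sub>s u\<^sub>t L\<close> has no non-zero vector of supremum norm less than \<open>exp (- c)\<close>.\<close>

definition boxfree :: "real \<Rightarrow> (real^2) set \<Rightarrow> real \<Rightarrow> real \<Rightarrow> bool" where
  "boxfree t L s c \<longleftrightarrow> (\<forall>v\<in>L. v \<noteq> 0 \<longrightarrow> exp (- c - s) \<le> \<bar>lform t v\<bar> \<or> exp (s - c) \<le> \<bar>v $ 2\<bar>)"

lemma snd_orb: "snd (orb d P k) = fst (orb d P (Suc k))"
  by (simp add: child_def)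

lemma yc_props:
  assumes "pair_ok P"
  shows "0 \<le> yc d P k" "yc d P k \<le> yc d P (Suc k)" "0 < yc d P (Suc k)"
  using pair_ok_orb[OF assms, of d k] by (auto simp: pair_ok_def snd_orb simp del: orb.simps)

lemma yc_rec: "yc d P (Suc (Suc k)) = yc d P k + (real (d k) + 1) * yc d P (Suc k)"
  by (simp add: child_def algebra_simps)

text \<open>Growth of Fibonacci type: even with all partial quotients equal to 1, two steps at least
  double the coordinate.\<close>

lemma yc_growth:
  assumes "pair_ok P"
  shows "yc d P 1 * 2 ^ (k div 2) \<le> yc d P (Suc k)"
proof (induction k rule: nat_induct2)
  case (step k)
  have "yc d P (Suc k) + 1 * yc d P (Suc (Suc k)) \<le> yc d P (Suc k) + (real (d (Suc k)) + 1) * yc d P (Suc (Suc k))"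
    using yc_props[OF assms, of d "Suc k"] by (intro add_left_mono mult_right_mono) auto
  then have "2 * yc d P (Suc k) \<le> yc d P (Suc (Suc (Suc k)))"
    using yc_props(2)[OF assms, of d "Suc k"] unfolding yc_rec[of d P "Suc k"] by linarith
  then show ?case using step by (simp del: orb.simps)
qed (use yc_props(2)[OF assms, of d 1] in \<open>simp_all del: orb.simps\<close>)

lemma orbit_sign:
  assumes "orbit t d P"
  shows "lform t (fst (orb d P k)) * lform t (fst (orb d P (Suc k))) < 0" "xc t d P (Suc k) < xc t d P k"
proof -
  let ?v = "lform t (fst (orb d P k))" and ?w = "lform t (fst (orb d P (Suc k)))"
  have "?w * (?v + ?w) < 0"
    using assms by (simp add: orbit_def cyl_def snd_orb del: orb.simps)
  then show "?v * ?w < 0" "\<bar>?w\<bar> < \<bar>?v\<bar>"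
    by (auto simp: mult_less_0_iff abs_if split: if_splits)
qed

lemma xc_pos: "orbit t d P \<Longrightarrow> 0 < xc t d P k"
  using orbit_sign(1)[of t d P k] by auto

lemma abs_eq_of_alternating:
  fixes a b c m :: real
  assumes "a * b < 0" "b * c < 0" "c = a + m * b"
  shows "\<bar>a\<bar> = m * \<bar>b\<bar> + \<bar>c\<bar>"
  using assms by (auto simp: mult_less_0_iff)

lemma xc_rec:
  assumes "orbit t d P"
  shows "xc t d P k = (real (d k) + 1) * xc t d P (Suc k) + xc t d P (Suc (Suc k))"
proof -
  have "lform t (fst (orb d P (Suc (Suc k)))) =
      lform t (fst (orb d P k)) + (real (d k) + 1) * lform t (fst (orb d P (Suc k)))"
    by (simp add: child_def algebra_simps)
  then show ?thesis by (rule abs_eq_of_alternating[OF orbit_sign(1)[OF assms] orbit_sign(1)[OF assms]])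
qed

text \<open>The determinant of two consecutive vectors; as their forms have opposite signs, its two
  terms do not cancel.\<close>

lemma xc_yc:
  assumes "pair_ok P" "orbit t d P"
  shows "xc t d P k * yc d P (Suc k) + xc t d P (Suc k) * yc d P k = 1"
proof -
  have "\<bar>cross2 (fst (orb d P k)) (fst (orb d P (Suc k)))\<bar> = 1"
    using pair_ok_orb[OF assms(1), of d k] by (simp add: pair_ok_def snd_orb del: orb.simps)
  then have *: "\<bar>lform t (fst (orb d P k)) * yc d P (Suc k) - lform t (fst (orb d P (Suc k))) * yc d P k\<bar> = 1"
    by (simp only: cross2_lform[of _ _ t])
  have y: "0 \<le> yc d P k" "0 \<le> yc d P (Suc k)" using yc_props[OF assms(1), of d] by (auto intro: less_imp_le)
  consider "0 < lform t (fst (orb d P k))" "lform t (fst (orb d P (Suc k))) < 0"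
    | "lform t (fst (orb d P k)) < 0" "0 < lform t (fst (orb d P (Suc k)))"
    using orbit_sign(1)[OF assms(2), of k] by (auto simp: mult_less_0_iff)
  then show ?thesis
  proof cases
    case 1
    have "0 \<le> lform t (fst (orb d P k)) * yc d P (Suc k)" "lform t (fst (orb d P (Suc k))) * yc d P k \<le> 0"
      using 1 y by (auto simp: mult_nonneg_nonneg mult_nonpos_nonneg simp del: orb.simps)
    then show ?thesis using * 1 by (simp del: orb.simps)
  next
    case 2
    have "lform t (fst (orb d P k)) * yc d P (Suc k) \<le> 0" "0 \<le> lform t (fst (orb d P (Suc k))) * yc d P k"
      using 2 y by (auto simp: mult_nonneg_nonneg mult_nonpos_nonneg simp del: orb.simps)
    then show ?thesis using * 2 by (simp del: orb.simps)
  qed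
qed

lemma abs_le_mult_of_int: "m \<noteq> 0 \<Longrightarrow> \<bar>x\<bar> \<le> \<bar>of_int m\<bar> * \<bar>x :: real\<bar>"
proof -
  assume "m \<noteq> 0"
  then have "1 \<le> \<bar>of_int m :: real\<bar>" by linarith
  from mult_right_mono[OF this, of "\<bar>x\<bar>"] show ?thesis by simp
qed

lemma abs_add_same_sign: "0 \<le> (x :: real) * y \<Longrightarrow> \<bar>x + y\<bar> = \<bar>x\<bar> + \<bar>y\<bar>"
  by (auto simp: zero_le_mult_iff)

text \<open>Write z = m v + n w in the basis of consecutive vectors. If m and n have weakly equal
  signs and n is non-zero, the second coordinates add up and z is at least as high as w. Otherwise
  the forms, of opposite signs for v and w, add up and z is at least as wide as v.\<close>

lemma boxfree_orb:
  assumes L: "L \<in> Xlat" and P: "pair_ok P" and o: "orbit t d P"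
    and mem: "\<And>k. fst (orb d P k) \<in> L"
    and c: "exp (- c - s) \<le> xc t d P k" "exp (s - c) \<le> yc d P (Suc k)"
  shows "boxfree t L s c"
  unfolding boxfree_def
proof (intro ballI impI)
  fix z assume z: "z \<in> L" "z \<noteq> 0"
  define v w where "v = fst (orb d P k)" and "w = fst (orb d P (Suc k))"
  have "\<bar>cross2 v w\<bar> = 1"
    using pair_ok_orb[OF P, of d k] by (simp add: pair_ok_def snd_orb v_def w_def del: orb.simps)
  then obtain m n where mn: "z = of_int m *\<^sub>R v + of_int n *\<^sub>R w"
    using Xlat_basis[OF L mem mem z(1), of k "Suc k"] by (auto simp: v_def w_def)
  have y: "0 \<le> v $ 2" "0 < w $ 2" using yc_props[OF P, of d k] by (auto simp: v_def w_def simp del: orb.simps)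
  have sg: "lform t v * lform t w < 0" using orbit_sign(1)[OF o, of k] by (simp add: v_def w_def del: orb.simps)
  have lz: "lform t z = of_int m * lform t v + of_int n * lform t w"
    and yz: "z $ 2 = of_int m * v $ 2 + of_int n * w $ 2" by (simp_all add: mn)
  have "\<bar>lform t v\<bar> \<le> \<bar>lform t z\<bar> \<or> w $ 2 \<le> \<bar>z $ 2\<bar>"
  proof (cases "n \<noteq> 0 \<and> 0 \<le> m * n")
    case True
    have "0 \<le> (of_int m * v $ 2) * (of_int n * w $ 2)"
    proof -
      have "0 \<le> real_of_int (m * n) * (v $ 2 * w $ 2)"
        using True y by (intro mult_nonneg_nonneg[of "real_of_int (m * n)"] mult_nonneg_nonneg[of "v $ 2"])
          (simp_all only: of_int_0_le_iff less_imp_le)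
      then show ?thesis by (simp add: mult_ac)
    qed
    then have "\<bar>z $ 2\<bar> = \<bar>of_int m * v $ 2\<bar> + \<bar>of_int n * w $ 2\<bar>"
      unfolding yz by (rule abs_add_same_sign)
    moreover have "w $ 2 \<le> \<bar>of_int n * w $ 2\<bar>"
      using abs_le_mult_of_int[of n "w $ 2"] True y by (simp add: abs_mult)
    ultimately show ?thesis by linarith
  next
    case False
    then have m: "m \<noteq> 0" "m * n \<le> 0" using z(2) by (auto simp: mn)
    have "0 \<le> (of_int m * lform t v) * (of_int n * lform t w)"
    proof -
      have "0 \<le> real_of_int (m * n) * (lform t v * lform t w)"
        using m sg by (intro mult_nonpos_nonpos[of "real_of_int (m * n)"]) (simp_all only: of_int_le_0_iff less_imp_le)
      then show ?thesis by (simp add: mult_ac)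
    qed
    then have "\<bar>lform t z\<bar> = \<bar>of_int m * lform t v\<bar> + \<bar>of_int n * lform t w\<bar>"
      unfolding lz by (rule abs_add_same_sign)
    moreover have "\<bar>lform t v\<bar> \<le> \<bar>of_int m * lform t v\<bar>"
      using abs_le_mult_of_int[OF m(1), of "lform t v"] by (simp add: abs_mult)
    ultimately show ?thesis by linarith
  qed
  then show "exp (- c - s) \<le> \<bar>lform t z\<bar> \<or> exp (s - c) \<le> \<bar>z $ 2\<bar>"
    using c by (auto simp: v_def w_def simp del: orb.simps)
qed

text \<open>The time \<open>s\<close> turns the empty box with half-sides x = \<open>xc\<close>
  (k+1) and y = \<open>yc\<close> (k+2) into a square of half-side sqrt (x y). The complementary
  product x' y' is at most x y / N, so x y >= 1/(1 + 1/N) >= exp (-1/N), which explains the bound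
  1/(2N). As ln x + ln y lies in [-1, 0], \<open>s\<close> is ln y up to a bounded error.\<close>

lemma boxfree_of_large_digits:
  assumes L: "L \<in> Xlat" and P: "pair_ok P" and o: "orbit t d P"
    and mem: "\<And>k. fst (orb d P k) \<in> L"
    and N: "1 \<le> N" "N \<le> (real (d k) + 1) * (real (d (Suc k)) + 1)"
  defines "s \<equiv> (ln (yc d P (Suc (Suc k))) - ln (xc t d P (Suc k))) / 2"
  shows "1 / (2 * N) \<le> c \<Longrightarrow> boxfree t L s c" "ln (yc d P (Suc (Suc k))) \<le> s" "s \<le> ln (yc d P (Suc (Suc k))) + 1"
proof -
  define x x' y y' where "x = xc t d P (Suc k)" and "x' = xc t d P (Suc (Suc k))"
    and "y = yc d P (Suc (Suc k))" and "y' = yc d P (Suc k)"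
  note defs = x_def x'_def y_def y'_def
  have pos: "0 < x" "0 < x'" "0 < y" "0 < y'"
    unfolding defs using xc_pos[OF o] yc_props[OF P] by blast+
  have xy: "x * y + x' * y' = 1" unfolding defs by (rule xc_yc[OF P o])
  have "(real (d k) + 1) * y' \<le> y" unfolding defs yc_rec using yc_props(1)[OF P] by simp
  moreover have "(real (d (Suc k)) + 1) * x' \<le> x"
    unfolding defs xc_rec[OF o, of "Suc k"] using xc_pos[OF o, of "Suc (Suc (Suc k))"] by linarith
  ultimately have "((real (d k) + 1) * y') * ((real (d (Suc k)) + 1) * x') \<le> y * x"
    using pos by (intro mult_mono) auto
  moreover have "N * (x' * y') \<le> (real (d k) + 1) * (real (d (Suc k)) + 1) * (x' * y')"
    using N(2) pos by (intro mult_right_mono) auto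
  ultimately have "N * (x' * y') \<le> x * y" by (simp only: mult_ac)
  then have "x' * y' \<le> (1 / N) * (x * y)" using N(1) by (simp add: field_simps)
  then have "1 \<le> (1 + 1 / N) * (x * y)" using xy by (simp add: algebra_simps)
  also have "\<dots> \<le> exp (1 / N) * (x * y)"
    using pos by (intro mult_right_mono exp_ge_add_one_self) auto
  finally have "ln 1 \<le> ln (exp (1 / N) * (x * y))" using pos N(1) by (subst ln_le_cancel_iff) auto
  then have lo: "0 \<le> 1 / N + (ln x + ln y)" using pos by (simp add: ln_mult)
  have "0 \<le> x' * y'" using pos by simp
  then have "x * y \<le> 1" using xy by linarith
  then have "ln (x * y) \<le> 0" using pos by simp
  then have hi: "ln x + ln y \<le> 0" using pos by (simp add: ln_mult)
  have s: "s = (ln y - ln x) / 2" by (simp add: s_def defs del: orb.simps)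
  have "1 / N \<le> 1" using N(1) by simp
  then show "ln (yc d P (Suc (Suc k))) \<le> s" "s \<le> ln (yc d P (Suc (Suc k))) + 1"
    unfolding y_def[symmetric] s using lo hi by auto
  show "boxfree t L s c" if "1 / (2 * N) \<le> c"
  proof (rule boxfree_orb[OF L P o mem, where k="Suc k"])
    have c: "1 / N \<le> 2 * c" using that N(1) by (simp add: field_simps)
    have lc: "0 \<le> 2 * c + (ln x + ln y)" using lo c by linarith
    have "exp (- c - s) \<le> exp (ln x)" unfolding exp_le_cancel_iff s using lc by argo
    then show "exp (- c - s) \<le> xc t d P (Suc k)" using pos unfolding x_def[symmetric] by (simp only: exp_ln)
    have "exp (s - c) \<le> exp (ln y)" unfolding exp_le_cancel_iff s using lc by argo
    then show "exp (s - c) \<le> yc d P (Suc (Suc k))" using pos unfolding y_def[symmetric] by (simp only: exp_ln)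
  qed
qed

text \<open>The first vector narrower than exp (-c-s) must be tall, and its predecessor is not
  narrow; hence x y >= exp (-2c) and x' y' <= 2c for this box. Since each coordinate exceeds its
  neighbour by a factor of at most the partial quotient plus one, x y <= 4 x' y' times the product
  of two partial quotients. The hypothesis on \<open>K\<close> forces the index to be late.\<close>

lemma large_digits_of_boxfree:
  assumes P: "pair_ok P" and o: "orbit t d P" and mem: "\<And>k. fst (orb d P k) \<in> L"
    and box: "boxfree t L s c" and c: "0 < c" "c \<le> 1" and K: "exp (- s) \<le> xc t d P (Suc K)"
  obtains j where "K \<le> j" "ln (yc d P (Suc (Suc j))) \<le> s + 1"
    "1 / (72 * c) \<le> (real (d j) + 1) * (real (d (Suc j)) + 1)"
proof -
  let ?e = "exp (- c - s)"
  have xyle: "xc t d P k * yc d P (Suc k) \<le> 1" for k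
  proof -
    have "0 \<le> xc t d P (Suc k) * yc d P k" using yc_props(1)[OF P] by (intro mult_nonneg_nonneg) auto
    then show ?thesis using xc_yc[OF P o, of k] by linarith
  qed
  \<comment> \<open>The form of the k-th vector is at most the reciprocal of the next second
    coordinate, hence tends to 0.\<close>
  have ex: "\<exists>k. xc t d P k < ?e"
  proof -
    have y1: "0 < yc d P 1" using yc_props(3)[OF P, of d 0] by simp
    obtain n where n: "1 / (?e * yc d P 1) < 2 ^ n" using real_arch_pow[of 2] by auto
    have e: "0 < ?e * yc d P 1" using y1 by simp
    have "1 < ?e * (yc d P 1 * 2 ^ n)" using n y1 by (simp add: divide_less_eq mult_ac)
    also have "\<dots> \<le> ?e * yc d P (Suc (2 * n))"
      using yc_growth[OF P, of d "2 * n"] by (intro mult_left_mono) auto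
    finally have "xc t d P (2 * n) * yc d P (Suc (2 * n)) < ?e * yc d P (Suc (2 * n))"
      using xyle[of "2 * n"] by linarith
    then have "xc t d P (2 * n) < ?e"
      using yc_props(3)[OF P, of d "2 * n"] by (simp only: mult_less_cancel_right_pos)
    then show ?thesis ..
  qed
  define k' where "k' = (LEAST k. xc t d P k < ?e)"
  have k': "xc t d P k' < ?e" unfolding k'_def using LeastI_ex[OF ex] .
  have "exp (- c - s) \<le> exp (- s)" using c by simp
  then have "?e \<le> xc t d P (Suc K)" using K by linarith
  have dec: "xc t d P b \<le> xc t d P a" if "a \<le> b" for a b
    using that
  proof (induction rule: dec_induct)
    case (step n)
    then show ?case using orbit_sign(2)[OF o, of n] by linarith
  qed simp
  have "Suc K < k'"
  proof (rule ccontr)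
    assume "\<not> Suc K < k'"
    then have "xc t d P (Suc K) \<le> xc t d P k'" by (intro dec) simp
    then show False using k' \<open>?e \<le> xc t d P (Suc K)\<close> by linarith
  qed
  \<comment> \<open>The vector \<open>k'\<close> is produced by the digit \<open>j\<close>;
    \<open>Suc K < k'\<close> makes the subtraction exact and gives \<open>K <= j\<close>.\<close>
  define j where "j = k' - 2"
  have j: "k' = Suc (Suc j)" "K \<le> j" using \<open>Suc K < k'\<close> by (auto simp: j_def)
  have x: "?e \<le> xc t d P (Suc j)"
    using not_less_Least[of "Suc j" "\<lambda>k. xc t d P k < ?e"] j(1) by (simp add: k'_def[symmetric] not_less del: orb.simps)
  have "fst (orb d P k') \<noteq> 0" using xc_pos[OF o, of k'] by (auto simp: lform_def)
  then have "exp (s - c) \<le> \<bar>yc d P k'\<bar>" using box mem[of k'] k' by (auto simp: boxfree_def)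
  then have y: "exp (s - c) \<le> yc d P (Suc (Suc j))" using yc_props(1)[OF P, of d k'] by (simp add: j(1) del: orb.simps)
  define x x' y y' where "x = xc t d P (Suc j)" and "x' = xc t d P (Suc (Suc j))"
    and "y = yc d P (Suc (Suc j))" and "y' = yc d P (Suc j)"
  note defs = x_def x'_def y_def y'_def
  have pos: "0 < x" "0 < x'" "0 < y" "0 < y'"
    unfolding defs using xc_pos[OF o] yc_props[OF P] by blast+
  have xy: "x * y + x' * y' = 1" unfolding defs by (rule xc_yc[OF P o])
  have "?e * exp (s - c) \<le> x * y" using x \<open>exp (s - c) \<le> yc d P (Suc (Suc j))\<close> by (intro mult_mono) (auto simp: defs simp del: orb.simps)
  then have e2: "exp (- 2 * c) \<le> x * y" by (simp add: exp_add[symmetric])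
  have "1 - 2 * c \<le> exp (- 2 * c)" using exp_ge_add_one_self[of "- 2 * c"] by simp
  then have small: "x' * y' \<le> 2 * c" using xy e2 by linarith
  have "y \<le> (real (d j) + 2) * y'"
    unfolding defs yc_rec using yc_props(2)[OF P, of d j] by (simp add: algebra_simps del: orb.simps)
  moreover have "x \<le> (real (d (Suc j)) + 2) * x'"
    unfolding defs xc_rec[OF o, of "Suc j"] using orbit_sign(2)[OF o, of "Suc (Suc j)"] by (simp add: algebra_simps del: orb.simps)
  ultimately have "x * y \<le> ((real (d (Suc j)) + 2) * x') * ((real (d j) + 2) * y')"
    using pos by (intro mult_mono) auto
  also have "\<dots> = ((real (d j) + 2) * (real (d (Suc j)) + 2)) * (x' * y')" by (simp add: mult_ac)
  also have "\<dots> \<le> ((2 * (real (d j) + 1)) * (2 * (real (d (Suc j)) + 1))) * (2 * c)"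
  proof (rule mult_mono[OF _ small])
    show "(real (d j) + 2) * (real (d (Suc j)) + 2) \<le> (2 * (real (d j) + 1)) * (2 * (real (d (Suc j)) + 1))"
      by (rule mult_mono) auto
  qed (use pos in auto)
  also have "\<dots> = 8 * c * ((real (d j) + 1) * (real (d (Suc j)) + 1))" by (simp only: mult_ac)
  finally have "exp (- 2 * c) \<le> 8 * c * ((real (d j) + 1) * (real (d (Suc j)) + 1))" using e2 by linarith
  \<comment> \<open>This 9 and the factor 8 just obtained make the 72 of the conclusion.\<close>
  moreover have "1 / 9 \<le> exp (- 2 * c)"
  proof -
    have "exp 2 = exp 1 * (exp 1 :: real)" by (simp add: exp_add[symmetric])
    also have "\<dots> \<le> 3 * 3" using exp_le by (intro mult_mono) auto
    finally have "1 / 9 \<le> exp (- 2 :: real)" by (simp add: exp_minus field_simps)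
    also have "\<dots> \<le> exp (- 2 * c)" using c by simp
    finally show ?thesis .
  qed
  ultimately have "1 \<le> 72 * c * ((real (d j) + 1) * (real (d (Suc j)) + 1))" by linarith
  then have "1 / (72 * c) \<le> (real (d j) + 1) * (real (d (Suc j)) + 1)"
    using c by (simp add: divide_le_eq mult_ac)
  moreover have "ln y \<le> s + 1"
  proof -
    have "?e * y \<le> x * y" using x pos unfolding x_def[symmetric] by (intro mult_right_mono) auto
    also have "\<dots> \<le> 1" unfolding defs by (rule xyle)
    finally have "?e * y \<le> 1" .
    then have "ln (?e * y) \<le> 0" using pos by (subst ln_le_zero_iff) auto
    then show ?thesis using pos c by (simp add: ln_mult)
  qed
  ultimately show ?thesis using j(2) that[of j] by (simp add: y_def del: orb.simps)
qed

section \<open>Almost every translate of a fixed lattice\<close>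

text \<open>The function x log (1/x) decreases near 1 and vanishes there. Adding x makes it
  increasing on (0,1], as comparisons need, without affecting convergence.\<close>

definition rl :: "real \<Rightarrow> real" where
  "rl x = x * (1 - ln x)"

lemma rl_nonneg: "0 < x \<Longrightarrow> x \<le> 1 \<Longrightarrow> 0 \<le> rl x"
  by (simp add: rl_def ln_le_zero_iff order_trans[of "ln x" 0 1])

lemma rl_mono:
  assumes "0 < x" "x \<le> y" "y \<le> 1" shows "rl x \<le> rl y"
proof -
  have "ln (y / x) \<le> y / x - 1" using assms by (intro ln_le_minus_one) auto
  then have "x * ln (y / x) \<le> x * (y / x - 1)" using assms by (intro mult_left_mono) auto
  then have "x * (ln y - ln x) \<le> y - x" using assms by (simp add: ln_div right_diff_distrib)
  moreover have "(y - x) * ln y \<le> 0" using assms by (intro mult_nonneg_nonpos) auto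
  ultimately show ?thesis by (simp add: rl_def algebra_simps)
qed

lemma harm_le_ln: "1 \<le> n \<Longrightarrow> harm n \<le> ln (real n) + 1"
proof (induction n rule: dec_induct)
  case base
  then show ?case by (simp add: harm_expand)
next
  case (step n)
  have "ln (real n / real (Suc n)) \<le> real n / real (Suc n) - 1"
    using step by (intro ln_le_minus_one) auto
  then have "ln (real n) - ln (real (Suc n)) \<le> - inverse (real (Suc n))"
    using step by (simp add: ln_div field_simps)
  then show ?case using step by (simp add: harm_Suc)
qed

text \<open>The threshold is that of \<open>large_digits_of_boxfree\<close>. Rounding down with
  minimum 1 costs at most a factor 2, whence 144; the numerator is at most 1 - ln R because N <=
  1/R.\<close>

lemma harm_ratio_upper:
  assumes "0 < R" "R < 1"
  defines "N \<equiv> max 1 (nat \<lfloor>1 / (72 * R)\<rfloor>)"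
  shows "harm N / real N \<le> 144 * rl R"
proof -
  have N1: "1 \<le> N" by (simp add: N_def)
  have z: "0 \<le> 1 / (72 * R)" using assms by simp
  have fl: "real (nat \<lfloor>1 / (72 * R)\<rfloor>) = of_int \<lfloor>1 / (72 * R)\<rfloor>" using z by simp
  have "1 / (72 * R) < real N + 1" using fl unfolding N_def by linarith
  then have "1 / (144 * R) \<le> real N"
  proof -
    have "1 / (144 * R) = (1 / (72 * R)) / 2" by simp
    moreover have "real N + 1 \<le> 2 * real N" using N1 by simp
    ultimately show ?thesis using \<open>1 / (72 * R) < real N + 1\<close> by linarith
  qed
  then have inv: "1 / real N \<le> 144 * R" using assms N1 by (simp add: field_simps)
  have "real N \<le> 1 / R"
  proof -
    have "1 / (72 * R) \<le> 1 / R" "1 \<le> 1 / R" using assms by (simp_all add: field_simps)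
    then show ?thesis unfolding N_def using fl by (simp add: max_def) linarith
  qed
  then have "ln (real N) \<le> ln (1 / R)" using N1 assms by (subst ln_le_cancel_iff) auto
  then have "harm N \<le> 1 - ln R" using harm_le_ln[OF N1] assms by (simp add: ln_div)
  then have "harm N * (1 / real N) \<le> (1 - ln R) * (144 * R)"
    using inv assms by (intro mult_mono) (auto simp: order_trans[of "ln R" 0 1])
  then show ?thesis by (simp add: rl_def mult_ac)
qed

text \<open>Rounding up ensures 1/(2N) <= R, as \<open>boxfree_of_large_digits\<close> requires. One
  factor 2 comes from N <= 2/R, the other from bounding both 1 and -ln R by
  \<open>harm N\<close>.\<close>

lemma harm_ratio_lower:
  assumes "0 < R" "R < 1"
  defines "N \<equiv> nat \<lceil>1 / R\<rceil>"
  shows "rl R \<le> 4 * (harm N / real N)"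
proof -
  have "1 < 1 / R" using assms by simp
  then have N: "1 / R \<le> real N" "real N \<le> 2 / R" "1 \<le> N" unfolding N_def by linarith+
  have "- ln R = ln (1 / R)" using assms by (simp add: ln_div)
  also have "\<dots> \<le> ln (real N + 1)"
  proof (rule ln_mono)
    show "1 / R \<le> real N + 1" using N(1) by linarith
  qed (use assms in auto)
  also have "\<dots> \<le> harm N" by (rule ln_le_harm)
  finally have "- ln R \<le> harm N" .
  moreover have "harm 1 \<le> (harm N :: real)" using N(3) by (rule harm_mono)
  then have "1 \<le> (harm N :: real)" by (simp add: harm_expand)
  ultimately have 1: "1 - ln R \<le> 2 * harm N" by linarith
  have "R \<le> 2 * (1 / real N)" using N assms by (simp add: field_simps)
  then have "R * (1 - ln R) \<le> (2 * (1 / real N)) * (2 * harm N)"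
    using 1 assms(1,2) by (intro mult_mono) (auto simp: order_trans[of "ln R" 0 1])
  then show ?thesis by (simp add: rl_def)
qed

text \<open>Each term is repeated \<open>C\<close> times, so the sum is multiplied by
  \<open>C\<close>.\<close>

lemma summable_div:
  fixes f :: "nat \<Rightarrow> real"
  assumes "summable f" "\<And>n. 0 \<le> f n" "0 < C"
  shows "summable (\<lambda>n. f (n div C))"
proof (rule bounded_imp_summable)
  fix n
  have "(\<Sum>k\<le>n. f (k div C)) \<le> (\<Sum>k<Suc n * C. f (k div C))"
  proof (rule sum_mono2)
    have "n < Suc n * C" using assms(3) by (cases C) auto
    then show "{..n} \<subseteq> {..<Suc n * C}" by auto
  qed (use assms in auto)
  also have "\<dots> = (\<Sum>m<Suc n. \<Sum>k=m * C..<m * C + C. f (k div C))"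
    by (simp only: sum.nat_group)
  also have "\<dots> = (\<Sum>m<Suc n. real C * f m)"
  proof (rule sum.cong[OF refl])
    fix m
    have "(\<Sum>k=m * C..<m * C + C. f (k div C)) = (\<Sum>k=m * C..<m * C + C. f m)"
      by (rule sum.cong) (auto intro!: arg_cong[of _ _ f] div_nat_eqI simp: mult.commute)
    then show "(\<Sum>k=m * C..<m * C + C. f (k div C)) = real C * f m" by simp
  qed
  also have "\<dots> \<le> real C * suminf f"
    unfolding sum_distrib_left[symmetric] using assms by (intro mult_left_mono sum_le_suminf) auto
  finally show "(\<Sum>k\<le>n. f (k div C)) \<le> real C * suminf f" .
qed (use assms in auto)

locale rate =
  fixes r :: "real \<Rightarrow> real" and s0 :: real
  assumes pos: "s0 \<le> s \<Longrightarrow> 0 < r s"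
    and noninc: "s0 \<le> s \<Longrightarrow> s \<le> t \<Longrightarrow> r t \<le> r s"
    and small: "\<exists>T. \<forall>s \<ge> T. r s < 1"
begin

text \<open>Clamped at \<open>s0\<close>, so that positivity and monotonicity hold at every natural
  number.\<close>

definition \<rho> :: "nat \<Rightarrow> real" where
  "\<rho> n = r (max s0 (real n))"

lemma \<rho>_pos: "0 < \<rho> n"
  unfolding \<rho>_def by (rule pos) simp

lemma \<rho>_antimono: "m \<le> n \<Longrightarrow> \<rho> n \<le> \<rho> m"
  unfolding \<rho>_def by (intro noninc) auto

lemma eventually_\<rho>: "\<forall>\<^sub>F n in sequentially. \<rho> n < 1"
proof -
  obtain T where T: "\<And>s. s \<ge> T \<Longrightarrow> r s < 1" using small by blast
  have "\<forall>n\<ge>nat \<lceil>T\<rceil>. \<rho> n < 1" unfolding \<rho>_def by (intro allI impI T) linarith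
  then show ?thesis unfolding eventually_sequentially by blast
qed

text \<open>The starting pair depends on t but always lies in the countable set
  \<open>L \<times> L\<close>, so one null set for each pair suffices.\<close>

lemma AE_pairs:
  assumes "L \<in> Xlat" "\<And>P. pair_ok P \<Longrightarrow> AE t in lborel. \<forall>d. orbit t d P \<longrightarrow> Q P d"
  shows "AE t in lborel. \<exists>P d. pair_ok P \<and> orbit t d P \<and> (\<forall>k. fst (orb d P k) \<in> L) \<and> Q P d"
proof -
  have count: "countable (L \<times> L)" using Xlat_countable[OF assms(1)] by simp
  have "AE t in lborel. \<forall>P\<in>L \<times> L. pair_ok P \<longrightarrow> (\<forall>d. orbit t d P \<longrightarrow> Q P d)"
    unfolding AE_ball_countable[OF count]
  proof
    fix P assume "P \<in> L \<times> L"
    show "AE t in lborel. pair_ok P \<longrightarrow> (\<forall>d. orbit t d P \<longrightarrow> Q P d)"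
    proof (cases "pair_ok P")
      case True
      from assms(2)[OF this] show ?thesis by eventually_elim blast
    qed simp
  qed
  with AE_generic[OF assms(1)] show ?thesis
  proof eventually_elim
    case (elim t)
    obtain P where P: "pair_ok P" "fst P \<in> L" "snd P \<in> L" "t \<in> cyl P"
      by (rule generic_start[OF assms(1) elim(1)])
    obtain d where d: "orbit t d P" "\<forall>k. fst (orb d P k) \<in> L"
      by (rule generic_orbit[OF assms(1) elim(1) P])
    have "P \<in> L \<times> L" using P by (cases P) auto
    with elim(2) P(1) d show ?case by blast
  qed
qed

lemma AE_not_boxfree:
  assumes L: "L \<in> Xlat" and sum: "summable (\<lambda>n. rl (min 1 (\<rho> n)))"
  shows "AE t in lborel. \<exists>T. \<forall>s\<ge>T. \<not> boxfree t L s (r s)"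
proof -
  \<comment> \<open>The second coordinate doubles every two steps and ln 2 >= 2/3, so its logarithm
    grows at a rate of at least 1/3. The smaller rate 1/4 absorbs the constants.\<close>
  define R where "R k = \<rho> (k div 4)" for k
  define N where "N k = max 1 (nat \<lfloor>1 / (72 * R k)\<rfloor>)" for k
  have R1: "\<forall>\<^sub>F k in sequentially. R k < 1"
  proof -
    obtain n0 where "\<And>n. n \<ge> n0 \<Longrightarrow> \<rho> n < 1" using eventually_\<rho> unfolding eventually_sequentially by blast
    then have "R k < 1" if "k \<ge> 4 * n0" for k using that unfolding R_def by auto
    then show ?thesis unfolding eventually_sequentially by blast
  qed
  have "summable (\<lambda>k. harm (N k) / real (N k) :: real)"
  proof (rule summable_comparison_test_ev)
    show "\<forall>\<^sub>F k in sequentially. norm (harm (N k) / real (N k) :: real) \<le> 144 * rl (min 1 (\<rho> (k div 4)))"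
      using R1
    proof eventually_elim
      case (elim k)
      have "min 1 (\<rho> (k div 4)) = R k" using elim by (simp add: R_def)
      then show ?case using harm_ratio_upper[of "R k"] elim \<rho>_pos[of "k div 4"]
        by (simp add: R_def N_def harm_nonneg)
    qed
    show "summable (\<lambda>k. 144 * rl (min 1 (\<rho> (k div 4))))"
      using \<rho>_pos by (intro summable_mult summable_div[OF sum]) (auto intro!: rl_nonneg)
  qed
  then have "AE t in lborel. \<exists>P d. pair_ok P \<and> orbit t d P \<and> (\<forall>k. fst (orb d P k) \<in> L) \<and>
      (\<forall>\<^sub>F k in sequentially. \<not> N k div Suc (d k) \<le> Suc (d (Suc k)))"
    by (intro AE_pairs L AE_eventually_not_hit) (auto simp: N_def)
  then show ?thesis
  proof eventually_elim
    case (elim t)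
    then obtain P d where P: "pair_ok P" and o: "orbit t d P" and mem: "\<And>k. fst (orb d P k) \<in> L"
      and ev: "\<forall>\<^sub>F k in sequentially. \<not> N k div Suc (d k) \<le> Suc (d (Suc k))" by blast
    have y1: "0 < yc d P 1" using yc_props(3)[OF P, of d 0] by simp
    have "\<forall>\<^sub>F k in sequentially. real (k div 4) \<le> ln (yc d P (Suc (Suc k))) - 1"
    proof -
      \<comment> \<open>From here on the surplus k/3 - k/4 = k/12 covers 1 - ln y_1.\<close>
      have "\<forall>\<^sub>F k in sequentially. 12 * (1 - ln (yc d P 1)) \<le> real k"
        using filterlim_real_sequentially by (simp add: filterlim_at_top)
      then show ?thesis
      proof eventually_elim
        case (elim k)
        have "ln (yc d P 1 * 2 ^ (Suc k div 2)) \<le> ln (yc d P (Suc (Suc k)))"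
          using yc_growth[OF P, of d "Suc k"] y1 yc_props(3)[OF P, of d "Suc k"]
          by (subst ln_le_cancel_iff) (auto simp del: orb.simps)
        then have 1: "ln (yc d P 1) + real (Suc k div 2) * ln 2 \<le> ln (yc d P (Suc (Suc k)))"
          using y1 by (simp add: ln_mult ln_realpow del: orb.simps)
        have 2: "real (Suc k div 2) * (2/3) \<le> real (Suc k div 2) * ln 2"
          using ln2_ge_two_thirds by (intro mult_left_mono) auto
        have 3: "real k / 2 \<le> real (Suc k div 2)" by linarith
        have 4: "real (k div 4) \<le> real k / 4" by linarith
        have "a + q * l \<le> Y \<Longrightarrow> q * (2/3) \<le> q * l \<Longrightarrow> x / 2 \<le> q \<Longrightarrow> m \<le> x / 4 \<Longrightarrow>
          12 * (1 - a) \<le> x \<Longrightarrow> m \<le> Y - 1" for a q l x m Y :: real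
          by argo
        from this[OF 1 2 3 4 elim] show ?case .
      qed
    qed
    with ev have "\<forall>\<^sub>F k in sequentially. \<not> N k div Suc (d k) \<le> Suc (d (Suc k)) \<and>
        real (k div 4) \<le> ln (yc d P (Suc (Suc k))) - 1" by eventually_elim auto
    then obtain K where K: "\<And>k. k \<ge> K \<Longrightarrow> \<not> N k div Suc (d k) \<le> Suc (d (Suc k))"
      "\<And>k. k \<ge> K \<Longrightarrow> real (k div 4) \<le> ln (yc d P (Suc (Suc k))) - 1"
      unfolding eventually_sequentially by blast
    obtain T0 where T0: "\<And>s. s \<ge> T0 \<Longrightarrow> r s < 1" using small by blast
    have "\<not> boxfree t L s (r s)" if s: "s \<ge> max s0 (max T0 (- ln (xc t d P (Suc K))))" for s
    proof
      assume box: "boxfree t L s (r s)"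
      have r: "0 < r s" "r s \<le> 1" using s pos[of s] T0[of s] by auto
      have "exp (- s) \<le> exp (ln (xc t d P (Suc K)))" using s by simp
      then have "exp (- s) \<le> xc t d P (Suc K)" using xc_pos[OF o, of "Suc K"] by (simp del: orb.simps)
      then obtain j where j: "K \<le> j" "ln (yc d P (Suc (Suc j))) \<le> s + 1"
        "1 / (72 * r s) \<le> (real (d j) + 1) * (real (d (Suc j)) + 1)"
        using large_digits_of_boxfree[OF P o mem box r, of K] by blast
      have "r s \<le> R j" unfolding R_def \<rho>_def using K(2)[OF j(1)] j(2) s by (intro noninc) auto
      then have "1 / (72 * R j) \<le> 1 / (72 * r s)" using r by (intro divide_left_mono) auto
      then have "1 / (72 * R j) \<le> real (Suc (d j) * Suc (d (Suc j)))" using j(3) by (simp add: algebra_simps)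
      then have "nat \<lfloor>1 / (72 * R j)\<rfloor> \<le> Suc (d j) * Suc (d (Suc j))" by linarith
      then have "N j \<le> Suc (d j) * Suc (d (Suc j))" by (simp add: N_def)
      \<comment> \<open>The rounding in \<open>hit\<close> enlarges the set: a product of partial
        quotients of at least \<open>N j\<close> always satisfies its condition.\<close>
      then have "N j div Suc (d j) \<le> (Suc (d j) * Suc (d (Suc j))) div Suc (d j)" by (rule div_le_mono)
      also have "\<dots> = Suc (d (Suc j))" by (rule nonzero_mult_div_cancel_left) simp
      finally show False using K(1)[OF j(1)] by simp
    qed
    then show ?case by blast
  qed
qed

lemma AE_boxfree:
  assumes L: "L \<in> Xlat" and div: "\<not> summable (\<lambda>n. rl (min 1 (\<rho> n)))"
  shows "AE t in lborel. \<forall>T. \<exists>s\<ge>T. s0 \<le> s \<and> boxfree t L s (r s)"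
proof -
  \<comment> \<open>For j >= 1 the digits 2j and 2j+1 act at a time of at most
    |\<open>growth_rate\<close>| (2j+1) + 1 <= 3 |\<open>growth_rate\<close>| j + j <= C j.\<close>
  define C where "C = nat \<lceil>3 * \<bar>growth_rate\<bar>\<rceil> + 1"
  have C: "0 < C" "3 * \<bar>growth_rate\<bar> + 1 \<le> real C" unfolding C_def by linarith+
  define R where "R j = \<rho> (C * j)" for j
  define N where "N j = nat \<lceil>1 / R j\<rceil>" for j
  have Rpos: "0 < R j" for j by (simp add: R_def \<rho>_pos)
  have N1: "1 \<le> N j" for j
  proof -
    have "0 < 1 / R j" using Rpos[of j] by simp
    then show ?thesis unfolding N_def by linarith
  qed
  have "\<not> summable (\<lambda>j. harm (N j) / real (N j) :: real)"
  proof
    assume *: "summable (\<lambda>j. harm (N j) / real (N j) :: real)"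
    have "summable (\<lambda>j. rl (min 1 (R j)))"
    proof (rule summable_comparison_test_ev[OF _ summable_mult[OF *, of 4]])
      obtain n0 where n0: "\<And>n. n \<ge> n0 \<Longrightarrow> \<rho> n < 1" using eventually_\<rho> unfolding eventually_sequentially by blast
      have "norm (rl (min 1 (R j))) \<le> 4 * (harm (N j) / real (N j))" if "j \<ge> n0" for j
      proof -
        have "n0 \<le> C * j" using that C(1) by (cases C) (auto intro: trans_le_add1)
        then have "R j < 1" unfolding R_def by (rule n0)
        then show ?thesis using harm_ratio_lower[OF Rpos[of j]] rl_nonneg[OF Rpos[of j]] by (simp add: N_def)
      qed
      then show "\<forall>\<^sub>F j in sequentially. norm (rl (min 1 (R j))) \<le> 4 * (harm (N j) / real (N j))"
        unfolding eventually_sequentially by blast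
    qed
    \<comment> \<open>As C * (n div C) <= n, monotonicity bounds every term by a sampled one, so
      divergence survives sampling at the multiples of \<open>C\<close>.\<close>
    then have "summable (\<lambda>n. rl (min 1 (R (n div C))))"
      using Rpos C(1) by (intro summable_div) (auto intro!: rl_nonneg)
    then have "summable (\<lambda>n. rl (min 1 (\<rho> n)))"
    proof (rule summable_comparison_test[rotated], intro exI allI impI)
      fix n
      have "\<rho> n \<le> R (n div C)" unfolding R_def by (intro \<rho>_antimono) simp
      then have "rl (min 1 (\<rho> n)) \<le> rl (min 1 (R (n div C)))"
        using \<rho>_pos[of n] by (intro rl_mono) auto
      moreover have "0 \<le> rl (min 1 (\<rho> n))" using \<rho>_pos[of n] by (intro rl_nonneg) auto
      ultimately show "norm (rl (min 1 (\<rho> n))) \<le> rl (min 1 (R (n div C)))" by simp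
    qed
    with div show False by simp
  qed
  then have "AE t in lborel. \<exists>P d. pair_ok P \<and> orbit t d P \<and> (\<forall>k. fst (orb d P k) \<in> L) \<and>
      ((\<exists>\<^sub>F j in sequentially. N j div Suc (d (2 * j)) \<le> d (2 * j + 1)) \<and>
      (\<forall>\<^sub>F k in sequentially. snd (orb d P k) $ 2 \<le> exp (growth_rate * real k)))"
  proof (intro AE_pairs L)
    fix P assume "pair_ok P" and *: "\<not> summable (\<lambda>j. harm (N j) / real (N j) :: real)"
    from AE_infinitely_good[OF this(1) N1 *] AE_eventually_growth[OF this(1)]
    show "AE t in lborel. \<forall>d. orbit t d P \<longrightarrow> (\<exists>\<^sub>F j in sequentially. N j div Suc (d (2 * j)) \<le> d (2 * j + 1)) \<and>
      (\<forall>\<^sub>F k in sequentially. snd (orb d P k) $ 2 \<le> exp (growth_rate * real k))"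
      by eventually_elim blast
  qed
  then show ?thesis
  proof eventually_elim
    case (elim t)
    then obtain P d where P: "pair_ok P" and o: "orbit t d P" and mem: "\<And>k. fst (orb d P k) \<in> L"
      and inf: "\<exists>\<^sub>F j in sequentially. N j div Suc (d (2 * j)) \<le> d (2 * j + 1)"
      and gr: "\<forall>\<^sub>F k in sequentially. snd (orb d P k) $ 2 \<le> exp (growth_rate * real k)" by blast
    have y1: "0 < yc d P 1" using yc_props(3)[OF P, of d 0] by simp
    show ?case
    proof
      fix T
      obtain K where K: "\<And>k. k \<ge> K \<Longrightarrow> snd (orb d P k) $ 2 \<le> exp (growth_rate * real k)"
        using gr unfolding eventually_sequentially by blast
      have "\<forall>\<^sub>F j in sequentially. 3 * (max T s0 - ln (yc d P 1)) \<le> 2 * real j"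
      proof -
        have "\<forall>\<^sub>F j in sequentially. 3 * (max T s0 - ln (yc d P 1)) / 2 \<le> real j"
          using filterlim_real_sequentially unfolding filterlim_at_top by blast
        then show ?thesis by eventually_elim argo
      qed
      then have "\<forall>\<^sub>F j in sequentially. 1 \<le> j \<and> K \<le> j \<and> 3 * (max T s0 - ln (yc d P 1)) \<le> 2 * real j"
        using eventually_ge_at_top[of 1] eventually_ge_at_top[of K] by eventually_elim auto
      then have "\<exists>\<^sub>F j in sequentially. N j div Suc (d (2 * j)) \<le> d (2 * j + 1) \<and> (1 \<le> j \<and> K \<le> j \<and> 3 * (max T s0 - ln (yc d P 1)) \<le> 2 * real j)"
        by (rule frequently_eventually_frequently[OF inf])
      then obtain j where j: "N j div Suc (d (2 * j)) \<le> d (2 * j + 1)" "1 \<le> j" "K \<le> j"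
        "3 * (max T s0 - ln (yc d P 1)) \<le> 2 * real j" using frequently_ex by blast
      \<comment> \<open>Here the rounding goes the other way: leaving \<open>bad\<close> forces a
        product of partial quotients above \<open>N j\<close>.\<close>
      have "N j < Suc (d (2 * j)) * Suc (N j div Suc (d (2 * j)))"
        using dividend_less_times_div[of "Suc (d (2 * j))" "N j"] by simp
      also have "\<dots> \<le> Suc (d (2 * j)) * Suc (d (Suc (2 * j)))" using j(1) by (intro mult_le_mono2) simp
      finally have "real (N j) \<le> real (Suc (d (2 * j)) * Suc (d (Suc (2 * j))))" by linarith
      then have N: "1 \<le> real (N j)" "real (N j) \<le> (real (d (2 * j)) + 1) * (real (d (Suc (2 * j))) + 1)"
        using N1[of j] by (simp_all add: algebra_simps)
      define y where "y = yc d P (Suc (Suc (2 * j)))"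
      define s where "s = (ln y - ln (xc t d P (Suc (2 * j)))) / 2"
      note large = boxfree_of_large_digits[OF L P o mem N, folded y_def, folded s_def]
      have ypos: "0 < y" unfolding y_def by (rule yc_props(3)[OF P])
      have "yc d P 1 * 2 ^ j \<le> y" using yc_growth[OF P, of d "Suc (2 * j)"] by (simp add: y_def del: orb.simps)
      then have "ln (yc d P 1 * 2 ^ j) \<le> ln y" using y1 ypos by (subst ln_le_cancel_iff) auto
      then have 1: "ln (yc d P 1) + real j * ln 2 \<le> ln y" using y1 by (simp add: ln_mult ln_realpow del: orb.simps)
      have 2: "real j * (2/3) \<le> real j * ln 2" using ln2_ge_two_thirds by (intro mult_left_mono) auto
      have "a + q * l \<le> Y \<Longrightarrow> q * (2/3) \<le> q * l \<Longrightarrow> Y \<le> z \<Longrightarrow> 3 * (m - a) \<le> 2 * q \<Longrightarrow> m \<le> z"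
        for a q l Y z m :: real by argo
      from this[OF 1 2 large(2) j(4)] have sT: "max T s0 \<le> s" .
      have "y \<le> exp (growth_rate * real (Suc (2 * j)))"
        using K[of "Suc (2 * j)"] j(3) by (simp add: y_def snd_orb del: orb.simps)
      then have "ln y \<le> ln (exp (growth_rate * real (Suc (2 * j))))" using ypos by (rule ln_mono)
      then have "ln y \<le> growth_rate * real (Suc (2 * j))" by (simp only: ln_exp)
      also have "\<dots> \<le> \<bar>growth_rate\<bar> * (3 * real j)" using j(2) by (intro mult_mono) auto
      finally have "s \<le> 3 * \<bar>growth_rate\<bar> * real j + 1 * real j" using large(3) j(2) by linarith
      also have "\<dots> \<le> real C * real j" using C(2) unfolding distrib_right[symmetric] by (intro mult_right_mono) auto
      finally have "R j \<le> r s" unfolding R_def \<rho>_def using sT by (intro noninc) auto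
      moreover have "1 / (2 * real (N j)) \<le> R j"
      proof -
        have "1 / R j \<le> real (N j)" unfolding N_def by linarith
        then have "1 \<le> R j * real (N j)" using Rpos[of j] by (simp add: divide_le_eq mult.commute)
        then show ?thesis using N(1) by (simp add: divide_le_eq)
      qed
      ultimately have "boxfree t L s (r s)" by (intro large(1)) linarith
      then show "\<exists>s\<ge>T. s0 \<le> s \<and> boxfree t L s (r s)" using sT by auto
    qed
  qed
qed

end

section \<open>Measurability and averaging over the unipotent flow\<close>

definition umat :: "real \<Rightarrow> real^2^2" where
  "umat t = (\<chi> i j. if i = j then 1 else if i = 1 then t else 0)"

lemma umat_apply: "(umat t *v v) $ 1 = lform t v" "(umat t *v v) $ 2 = v $ 2"
  by (simp_all add: umat_def matrix_vector_mult_def sum_2 lform_def)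

lemma amat_apply: "(amat s *v v) $ 1 = exp s * v $ 1" "(amat s *v v) $ 2 = exp (- s) * v $ 2"
  by (simp_all add: amat_def matrix_vector_mult_def sum_2)

lemma umat_SL2: "umat t \<in> SL2"
  by (simp add: SL2_def det_2 umat_def)

lemma amat_SL2: "amat s \<in> SL2"
  by (simp add: SL2_def det_2 amat_def exp_minus)

lemma act_Xlat:
  assumes "g \<in> SL2" "L \<in> Xlat" shows "act g L \<in> Xlat"
proof -
  obtain h where h: "h \<in> SL2" "L = lat h" using assms(2) by (auto simp: Xlat_def)
  have "act g L = lat (g ** h)" by (simp add: h(2) act_def lat_def image_image matrix_vector_mul_assoc)
  moreover have "g ** h \<in> SL2" using assms(1) h(1) by (simp add: SL2_def det_mul)
  ultimately show ?thesis by (simp add: Xlat_def)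
qed

lemma act_umat_0: "act (umat 0) L = L"
proof -
  have "umat 0 *v v = v" for v by (simp add: vec2_eq_iff umat_apply) (simp add: lform_def)
  then show ?thesis by (simp add: act_def)
qed

text \<open>The supremum in \<open>Delta\<close> must be shown to be over a non-empty bounded set:
  only finitely many lattice vectors have norm at most 1, and all others contribute negative
  logarithms.\<close>

lemma Kset_iff:
  assumes L: "L \<in> Xlat"
  shows "L \<in> Kset c \<longleftrightarrow> (\<forall>v\<in>L - {0}. exp (- c) \<le> supnorm v)"
proof -
  have pos: "0 < supnorm v" if "v \<noteq> 0" for v
    using that by (auto simp: supnorm_def vec2_eq_iff less_max_iff_disj)
  define F where "F = {z \<in> L. \<bar>lform 0 z\<bar> \<le> 1 \<and> \<bar>z $ 2\<bar> \<le> 1}"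
  have "(\<lambda>v. ln (1 / supnorm v)) ` (L - {0}) \<subseteq> (\<lambda>v. ln (1 / supnorm v)) ` F \<union> {..0}"
  proof safe
    fix v assume v: "v \<in> L" "v \<noteq> 0" "ln (1 / supnorm v) \<notin> (\<lambda>v. ln (1 / supnorm v)) ` F"
    then have "v \<notin> F" by blast
    then have "1 < supnorm v" using v(1) by (auto simp: F_def supnorm_def lform_def less_max_iff_disj)
    then show "ln (1 / supnorm v) \<le> 0" by (simp add: ln_div)
  qed
  moreover have "finite F" unfolding F_def by (rule Xlat_finite[OF L])
  ultimately have bdd: "bdd_above ((\<lambda>v. ln (1 / supnorm v)) ` (L - {0}))"
    by (meson bdd_above_mono bdd_above_Un bdd_above_finite finite_imageI bdd_above_Iic)
  have ne: "(\<lambda>v. ln (1 / supnorm v)) ` (L - {0}) \<noteq> {}"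
  proof -
    obtain e f where ef: "cross2 e f = 1" "L = {of_int m *\<^sub>R e + of_int n *\<^sub>R f | m n. True}"
      by (rule XlatE[OF L])
    have "e = of_int 1 *\<^sub>R e + of_int 0 *\<^sub>R f" by simp
    then have "e \<in> L" unfolding ef(2) by blast
    moreover have "e \<noteq> 0" using ef(1) by (auto simp: cross2_def)
    ultimately show ?thesis by blast
  qed
  have "L \<in> Kset c \<longleftrightarrow> (\<forall>v\<in>L - {0}. ln (1 / supnorm v) \<le> c)"
    unfolding Kset_def Delta_def using L cSup_le_iff[OF ne bdd, of c] by simp
  also have "\<dots> \<longleftrightarrow> (\<forall>v\<in>L - {0}. exp (- c) \<le> supnorm v)"
  proof (rule ball_cong[OF refl])
    fix v assume "v \<in> L - {0}"
    then have p: "0 < supnorm v" using pos by auto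
    have "exp (- c) \<le> supnorm v \<longleftrightarrow> - c \<le> ln (supnorm v)" using ln_ge_iff[OF p] by simp
    then show "ln (1 / supnorm v) \<le> c \<longleftrightarrow> exp (- c) \<le> supnorm v" using p by (auto simp: ln_div)
  qed
  finally show ?thesis .
qed

lemma act_Kset_iff:
  assumes L: "L \<in> Xlat"
  shows "act (amat s) (act (umat t) L) \<in> Kset c \<longleftrightarrow> boxfree t L s c"
proof -
  define f where "f v = amat s *v (umat t *v v)" for v
  have f: "f v $ 1 = exp s * lform t v" "f v $ 2 = exp (- s) * v $ 2" for v
    by (simp_all add: f_def amat_apply umat_apply)
  have f0: "f v = 0 \<longleftrightarrow> v = 0" for v
    by (auto simp: vec2_eq_iff f lform_def)
  have "supnorm (f v) = max (exp s * \<bar>lform t v\<bar>) (exp (- s) * \<bar>v $ 2\<bar>)" for v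
    by (simp add: supnorm_def f abs_mult)
  moreover have "exp (- c) \<le> exp s * x \<longleftrightarrow> exp (- c - s) \<le> x" "exp (- c) \<le> exp (- s) * x \<longleftrightarrow> exp (s - c) \<le> x" for x
    by (simp_all add: exp_diff exp_minus field_simps)
  ultimately have sn: "exp (- c) \<le> supnorm (f v) \<longleftrightarrow> exp (- c - s) \<le> \<bar>lform t v\<bar> \<or> exp (s - c) \<le> \<bar>v $ 2\<bar>" for v
    by (simp add: le_max_iff_disj)
  have image_0: "f ` L - {0} = f ` (L - {0})" using f0 by auto
  have "act (amat s) (act (umat t) L) = f ` L" by (simp add: act_def image_image f_def)
  then have "f ` L \<in> Xlat" using act_Xlat[OF amat_SL2 act_Xlat[OF umat_SL2 L]] by metis
  from Kset_iff[OF this, of c] have "f ` L \<in> Kset c \<longleftrightarrow> (\<forall>v\<in>L - {0}. exp (- c) \<le> supnorm (f v))"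
    unfolding image_0 by blast
  then show ?thesis
    unfolding \<open>act (amat s) (act (umat t) L) = f ` L\<close> boxfree_def sn by blast
qed

lemma act_Binf_iff:
  assumes L: "L \<in> Xlat"
  shows "act (umat t) L \<in> Binf r s0 \<longleftrightarrow> (\<forall>T. \<exists>s\<ge>T. s0 \<le> s \<and> boxfree t L s (r s))"
  using act_Xlat[OF umat_SL2 L] by (simp add: Binf_def act_Kset_iff[OF L])

section \<open>Measurability of the limsup set, jointly in t and the lattice\<close>

lemma boxfree_mono:
  assumes "boxfree t L s c" "c + \<bar>q - s\<bar> \<le> c'" shows "boxfree t L q c'"
proof -
  have "exp (- c' - q) \<le> exp (- c - s)" "exp (q - c') \<le> exp (s - c)" using assms(2) by auto
  with assms(1) show ?thesis unfolding boxfree_def by (meson order_trans)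
qed

lemma boxfree_limit:
  assumes "\<And>n. boxfree t L (s n) (c n)" "s \<longlonglongrightarrow> s'" "c \<longlonglongrightarrow> c'"
  shows "boxfree t L s' c'"
  unfolding boxfree_def
proof (intro ballI impI)
  fix v assume v: "v \<in> L" "v \<noteq> 0"
  show "exp (- c' - s') \<le> \<bar>lform t v\<bar> \<or> exp (s' - c') \<le> \<bar>v $ 2\<bar>"
  proof (rule ccontr)
    assume "\<not> ?thesis"
    then have lt: "\<bar>lform t v\<bar> < exp (- c' - s')" "\<bar>v $ 2\<bar> < exp (s' - c')" by auto
    have "(\<lambda>n. exp (- c n - s n)) \<longlonglongrightarrow> exp (- c' - s')" "(\<lambda>n. exp (s n - c n)) \<longlonglongrightarrow> exp (s' - c')"
      by (intro tendsto_intros assms)+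
    then have "\<forall>\<^sub>F n in sequentially. \<bar>lform t v\<bar> < exp (- c n - s n)" "\<forall>\<^sub>F n in sequentially. \<bar>v $ 2\<bar> < exp (s n - c n)"
      using lt by (auto intro: order_tendstoD)
    then have "\<forall>\<^sub>F n in sequentially. False"
    proof eventually_elim
      case (elim n)
      then show ?case using assms(1)[of n] v by (auto simp: boxfree_def)
    qed
    then show False by simp
  qed
qed

text \<open>Replaces a quantifier over real times by countable ones. Density of the rationals and
  continuity of \<open>r\<close> give the slack 1/(j+1); conversely, approximate times for all j lie
  in one compact interval, and a limit of a subsequence is an exact time because
  \<open>boxfree\<close> is a closed condition. For this, \<open>U\<close> has to be chosen before
  \<open>j\<close>.\<close>

lemma unbounded_boxfree_iff:
  assumes cont: "continuous_on {s0..} r"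
  shows "(\<forall>T. \<exists>s\<ge>T. s0 \<le> s \<and> boxfree t L s (r s)) \<longleftrightarrow>
    (\<forall>T::nat. s0 \<le> real T \<longrightarrow> (\<exists>U::nat. \<forall>j::nat. \<exists>q\<in>\<rat> \<inter> {real T..real U}. boxfree t L q (r q + 1 / (real j + 1))))"
    (is "?l \<longleftrightarrow> ?r")
proof
  assume l: ?l
  show ?r
  proof (intro allI impI)
    fix T :: nat assume T: "s0 \<le> real T"
    obtain s where s: "real T \<le> s" "s0 \<le> s" "boxfree t L s (r s)" using l by blast
    define U where "U = nat \<lceil>s\<rceil> + 1"
    have U: "s + 1 \<le> real U" unfolding U_def by linarith
    have "\<exists>q\<in>\<rat> \<inter> {real T..real U}. boxfree t L q (r q + 1 / (real j + 1))" for j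
    proof -
      define e where "e = 1 / (real j + 1)"
      have e: "0 < e" by (simp add: e_def)
      have "\<exists>d>0. \<forall>x'\<in>{s0..}. dist x' s < d \<longrightarrow> dist (r x') (r s) < e / 2"
        using cont[unfolded continuous_on_iff, rule_format, of s "e / 2"] s(2) e by simp
      then obtain d where d: "0 < d" "\<And>q. s0 \<le> q \<Longrightarrow> \<bar>q - s\<bar> < d \<Longrightarrow> \<bar>r q - r s\<bar> < e / 2"
        by (auto simp: dist_real_def)
      \<comment> \<open>The bound d controls \<open>r\<close>, 1 keeps q below U, and e / 2 controls
        the change of the box.\<close>
      have "s < s + min d (min 1 (e / 2))" using d(1) e by simp
      then obtain q where q: "q \<in> \<rat>" "s < q" "q < s + min d (min 1 (e / 2))"
        using Rats_dense_in_real by blast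
      have "\<bar>r q - r s\<bar> < e / 2" using q s by (intro d(2)) auto
      moreover have "\<bar>q - s\<bar> < e / 2" using q(2,3) by auto
      ultimately have "r s + \<bar>q - s\<bar> \<le> r q + e" by linarith
      then have "boxfree t L q (r q + e)" by (rule boxfree_mono[OF s(3)])
      moreover have "q \<in> {real T..real U}" using q s U by auto
      ultimately show ?thesis using q(1) by (auto simp: e_def)
    qed
    then show "\<exists>U::nat. \<forall>j::nat. \<exists>q\<in>\<rat> \<inter> {real T..real U}. boxfree t L q (r q + 1 / (real j + 1))" by blast
  qed
next
  assume r: ?r
  show ?l
  proof
    fix T0 :: real
    define T where "T = nat \<lceil>max s0 T0\<rceil>"
    have T: "s0 \<le> real T" "T0 \<le> real T" unfolding T_def by linarith+
    then obtain U where U: "\<And>j::nat. \<exists>q\<in>\<rat> \<inter> {real T..real U}. boxfree t L q (r q + 1 / (real j + 1))" using r by blast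
    then obtain q where q: "\<And>j::nat. q j \<in> {real T..real U}" "\<And>j. boxfree t L (q j) (r (q j) + 1 / (real j + 1))"
      by (metis IntD2)
    have "compact {real T..real U}" by simp
    then obtain s \<phi> where s: "s \<in> {real T..real U}" "strict_mono \<phi>" "(q \<circ> \<phi>) \<longlonglongrightarrow> s"
      using q(1) unfolding compact_def by blast
    have "(\<lambda>n. r ((q \<circ> \<phi>) n)) \<longlonglongrightarrow> r s"
    proof (rule continuous_on_tendsto_compose[OF cont s(3)])
      show "s \<in> {s0..}" using s(1) T(1) by auto
      have "(q \<circ> \<phi>) n \<in> {s0..}" for n using q(1)[of "\<phi> n"] T(1) by auto
      then show "\<forall>\<^sub>F n in sequentially. (q \<circ> \<phi>) n \<in> {s0..}" by simp
    qed
    moreover have "(\<lambda>j. 1 / (real j + 1)) \<longlonglongrightarrow> 0"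
      using LIMSEQ_inverse_real_of_nat by (simp add: inverse_eq_divide add.commute)
    then have "((\<lambda>j. 1 / (real j + 1)) \<circ> \<phi>) \<longlonglongrightarrow> 0" by (rule LIMSEQ_subseq_LIMSEQ[OF _ s(2)])
    ultimately have lim: "(\<lambda>n. r ((q \<circ> \<phi>) n) + ((\<lambda>j. 1 / (real j + 1)) \<circ> \<phi>) n) \<longlonglongrightarrow> r s + 0"
      by (rule tendsto_add)
    have "boxfree t L ((q \<circ> \<phi>) n) (r ((q \<circ> \<phi>) n) + ((\<lambda>j. 1 / (real j + 1)) \<circ> \<phi>) n)" for n
      using q(2)[of "\<phi> n"] by (simp only: comp_def)
    from boxfree_limit[OF this s(3) lim] have "boxfree t L s (r s + 0)" .
    then have "boxfree t L s (r s)" by simp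
    moreover have "T0 \<le> s" "s0 \<le> s" using s(1) T by auto
    ultimately show "\<exists>s\<ge>T0. s0 \<le> s \<and> boxfree t L s (r s)" by blast
  qed
qed

lemma space_Xmeas: "space Xmeas = Xlat"
  unfolding Xmeas_def by (rule space_measure_of) auto

lemma Xmeas_sets: "A \<subseteq> Xlat \<Longrightarrow> {g \<in> SL2. lat g \<in> A} \<in> sets borel \<Longrightarrow> A \<in> sets Xmeas"
  unfolding Xmeas_def by (subst sets_measure_of) auto

text \<open>In terms of g, some integer vector z satisfies \<open>g *v z \<in> R\<close>: a
  countable union of open conditions on the closed set \<open>SL2\<close>.\<close>

lemma hitting_sets:
  assumes "open R" shows "{L \<in> Xlat. L \<inter> R \<noteq> {}} \<in> sets Xmeas"
proof (rule Xmeas_sets)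
  \<comment> \<open>The lattice of the identity matrix is \<open>Zvec\<close> itself, whence the
    latter is countable.\<close>
  have "mat 1 \<in> SL2" by (simp add: SL2_def)
  then have "lat (mat 1) \<in> Xlat" by (simp add: Xlat_def)
  then have "countable (lat (mat 1))" by (rule Xlat_countable)
  then have Z: "countable Zvec" by (simp add: lat_def)
  have "closed SL2"
    unfolding SL2_def det_2 by (intro closed_Collect_eq continuous_intros)
  moreover have "open {g :: real^2^2. g *v z \<in> R}" for z
  proof -
    have "continuous_on UNIV (\<lambda>g :: real^2^2. g *v z)"
      unfolding matrix_vector_mult_def by (intro continuous_intros)
    from open_vimage[OF assms this] show ?thesis by (simp add: vimage_def)
  qed
  then have "(\<Union>z\<in>Zvec. {g :: real^2^2. g *v z \<in> R}) \<in> sets borel"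
    by (intro borel_open open_UN) blast
  moreover have "{g \<in> SL2. lat g \<in> {L \<in> Xlat. L \<inter> R \<noteq> {}}} = SL2 \<inter> (\<Union>z\<in>Zvec. {g. g *v z \<in> R})"
    by (auto simp: Xlat_def lat_def)
  ultimately show "{g \<in> SL2. lat g \<in> {L \<in> Xlat. L \<inter> R \<noteq> {}}} \<in> sets borel"
    by (simp add: borel_closed sets.Int)
qed auto

lemma open_eq_Union_boxes:
  fixes W :: "('a::second_countable_topology \<times> 'b::second_countable_topology) set"
  assumes "open W"
  obtains I where "countable I" "\<And>A B. (A, B) \<in> I \<Longrightarrow> open A \<and> open B" "W = (\<Union>(A, B)\<in>I. A \<times> B)"
proof -
  obtain \<A> :: "'a set set" where A: "countable \<A>" "topological_basis \<A>" using ex_countable_basis by blast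
  obtain \<B> :: "'b set set" where B: "countable \<B>" "topological_basis \<B>" using ex_countable_basis by blast
  define I where "I = {(U, V) \<in> \<A> \<times> \<B>. U \<times> V \<subseteq> W}"
  show ?thesis
  proof
    show "countable I" unfolding I_def by (rule countable_subset[of _ "\<A> \<times> \<B>"]) (use A B in auto)
    show "open U \<and> open V" if "(U, V) \<in> I" for U V
      using that topological_basis_open[OF A(2)] topological_basis_open[OF B(2)] by (auto simp: I_def)
    show "W = (\<Union>(U, V)\<in>I. U \<times> V)"
    proof safe
      fix x y assume "(x, y) \<in> W"
      then obtain S T where S: "open S" "open T" "x \<in> S" "y \<in> T" "S \<times> T \<subseteq> W"
        using assms by (auto elim!: open_prod_elim[of _ "(x, y)"])
      obtain U where U: "U \<in> \<A>" "x \<in> U" "U \<subseteq> S" using topological_basisE[OF A(2) S(1,3)] by blast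
      obtain V where V: "V \<in> \<B>" "y \<in> V" "V \<subseteq> T" using topological_basisE[OF B(2) S(2,4)] by blast
      have "(U, V) \<in> I" using U V S(5) by (auto simp: I_def)
      then show "(x, y) \<in> (\<Union>(U, V)\<in>I. U \<times> V)" using U V by blast
    qed (auto simp: I_def)
  qed
qed

text \<open>A countable decomposition of \<open>W\<close> into open boxes turns the set into a
  countable union of measurable rectangles.\<close>

lemma joint_hitting_sets:
  fixes W :: "(real \<times> (real^2)) set"
  assumes "open W"
  shows "{(t, L). L \<in> Xlat \<and> (\<exists>v\<in>L. (t, v) \<in> W)} \<in> sets (borel \<Otimes>\<^sub>M Xmeas)"
proof -
  obtain I where I: "countable I" "\<And>A B. (A, B) \<in> I \<Longrightarrow> open A \<and> open B" "W = (\<Union>(A, B)\<in>I. A \<times> B)"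
    by (rule open_eq_Union_boxes[OF assms]) blast
  have "{(t, L). L \<in> Xlat \<and> (\<exists>v\<in>L. (t, v) \<in> W)} = (\<Union>(A, B)\<in>I. A \<times> {L \<in> Xlat. L \<inter> B \<noteq> {}})"
    unfolding I(3) by fast
  also have "\<dots> \<in> sets (borel \<Otimes>\<^sub>M Xmeas)"
  proof (rule sets.countable_UN''[OF I(1)])
    fix p assume "p \<in> I"
    then show "(case p of (A, B) \<Rightarrow> A \<times> {L \<in> Xlat. L \<inter> B \<noteq> {}}) \<in> sets (borel \<Otimes>\<^sub>M Xmeas)"
      using I(2) by (cases p) (auto intro!: pair_measureI hitting_sets)
  qed
  finally show ?thesis .
qed

text \<open>The failure of \<open>boxfree\<close> means that the lattice meets an open set of short
  non-zero vectors, an open condition jointly in t and the vector.\<close>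

lemma boxfree_pred:
  "Measurable.pred (borel \<Otimes>\<^sub>M Xmeas) (\<lambda>p. boxfree (fst p) (snd p) s c)"
proof -
  define W where "W = {p :: real \<times> (real^2). snd p \<noteq> 0 \<and> \<bar>lform (fst p) (snd p)\<bar> < exp (- c - s) \<and> \<bar>snd p $ 2\<bar> < exp (s - c)}"
  have "open W"
    unfolding W_def lform_def by (intro open_Collect_conj open_Collect_less open_Collect_neq continuous_intros)
  from sets.compl_sets[OF joint_hitting_sets[OF this]]
  have "space (borel \<Otimes>\<^sub>M Xmeas) - {(t, L). L \<in> Xlat \<and> (\<exists>v\<in>L. (t, v) \<in> W)} \<in> sets (borel \<Otimes>\<^sub>M Xmeas)" .
  also have "space (borel \<Otimes>\<^sub>M Xmeas) - {(t, L). L \<in> Xlat \<and> (\<exists>v\<in>L. (t, v) \<in> W)} =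
      {p \<in> space (borel \<Otimes>\<^sub>M Xmeas). boxfree (fst p) (snd p) s c}"
    by (auto simp: space_pair_measure space_Xmeas boxfree_def W_def not_less)
  finally show ?thesis by (simp add: pred_def)
qed

lemma unbounded_boxfree_pred:
  assumes "continuous_on {s0..} r"
  shows "Measurable.pred (borel \<Otimes>\<^sub>M Xmeas) (\<lambda>p. \<forall>T. \<exists>s\<ge>T. s0 \<le> s \<and> boxfree (fst p) (snd p) s (r s))"
proof -
  have "Measurable.pred (borel \<Otimes>\<^sub>M Xmeas)
      (\<lambda>p. \<exists>q\<in>\<rat> \<inter> {real T..real U}. boxfree (fst p) (snd p) q (r q + 1 / (real j + 1)))" for T U j :: nat
    unfolding pred_def
  proof (rule sets.sets_Collect_countable_Ex')
    show "countable (\<rat> \<inter> {real T..real U})" using countable_rat by blast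
    show "{p \<in> space (borel \<Otimes>\<^sub>M Xmeas). boxfree (fst p) (snd p) q (r q + 1 / (real j + 1))}
        \<in> sets (borel \<Otimes>\<^sub>M Xmeas)" for q
      using boxfree_pred unfolding pred_def .
  qed
  then show ?thesis
    unfolding unbounded_boxfree_iff[OF assms] by (intro pred_intros_countable pred_intros_imp')
qed

text \<open>The slice at t = 0 of the jointly measurable set, since u_0 is the identity.\<close>

lemma Binf_sets:
  assumes "continuous_on {s0..} r" shows "Binf r s0 \<in> sets Xmeas"
proof -
  let ?E = "{p \<in> space (borel \<Otimes>\<^sub>M Xmeas). \<forall>T. \<exists>s\<ge>T. s0 \<le> s \<and> boxfree (fst p) (snd p) s (r s)}"
  have "?E \<in> sets (borel \<Otimes>\<^sub>M Xmeas)" using unbounded_boxfree_pred[OF assms] by (simp add: pred_def)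
  from sets_Pair1[OF this, of 0] have "Pair 0 -` ?E \<in> sets Xmeas" .
  also have "Pair 0 -` ?E = Binf r s0"
  proof -
    have "L \<in> Binf r s0 \<longleftrightarrow> L \<in> Xlat \<and> (\<forall>T. \<exists>s\<ge>T. s0 \<le> s \<and> boxfree 0 L s (r s))" for L
      using act_Binf_iff[of L 0 r s0] by (auto simp: act_umat_0 Binf_def)
    then show ?thesis by (auto simp: space_pair_measure space_Xmeas)
  qed
  finally show ?thesis .
qed

text \<open>By invariance and Fubini, \<open>emeasure M A\<close> times the infinite length of the line is the integral
  over \<open>L\<close> of the measure of \<open>{t. u\<^sub>t L \<in> A}\<close>.\<close>

lemma unipotent_null:
  assumes M: "haar_prob M" and A: "A \<in> sets Xmeas"
    and E: "{p \<in> space (borel \<Otimes>\<^sub>M Xmeas). act (umat (fst p)) (snd p) \<in> A} \<in> sets (borel \<Otimes>\<^sub>M Xmeas)"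
    and null: "\<And>L. L \<in> Xlat \<Longrightarrow> AE t in lborel. act (umat t) L \<notin> A"
  shows "emeasure M A = 0"
proof -
  have setsM: "sets M = sets Xmeas" and "prob_space M"
    and inv: "\<And>g B. g \<in> SL2 \<Longrightarrow> B \<in> sets M \<Longrightarrow> emeasure M (act g -` B \<inter> Xlat) = emeasure M B"
    using M by (auto simp: haar_prob_def)
  interpret M: prob_space M by fact
  interpret pair_sigma_finite lborel M ..
  have spM: "space M = Xlat" using sets_eq_imp_space_eq[OF setsM] by (simp add: space_Xmeas)
  define S where "S = {p \<in> space (borel \<Otimes>\<^sub>M Xmeas). act (umat (fst p)) (snd p) \<in> A}"
  have eq: "sets (lborel \<Otimes>\<^sub>M M) = sets (borel \<Otimes>\<^sub>M Xmeas)" by (intro sets_pair_measure_cong setsM) simp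
  have S: "S \<in> sets (lborel \<Otimes>\<^sub>M M)" using E unfolding S_def eq .
  have "emeasure (lborel \<Otimes>\<^sub>M M) S = (\<integral>\<^sup>+t. emeasure M (Pair t -` S) \<partial>lborel)"
    by (rule M.emeasure_pair_measure_alt[OF S])
  also have "\<dots> = (\<integral>\<^sup>+(t::real). emeasure M A \<partial>lborel)"
  proof (rule nn_integral_cong)
    fix t
    have "Pair t -` S = act (umat t) -` A \<inter> Xlat"
      by (auto simp: S_def space_pair_measure space_Xmeas)
    then show "emeasure M (Pair t -` S) = emeasure M A" using inv[OF umat_SL2, of A t] A setsM by simp
  qed
  also have "\<dots> = emeasure M A * \<infinity>" by simp
  finally have 1: "emeasure (lborel \<Otimes>\<^sub>M M) S = emeasure M A * \<infinity>" .
  have "emeasure (lborel \<Otimes>\<^sub>M M) S = (\<integral>\<^sup>+L. emeasure lborel ((\<lambda>t. (t, L)) -` S) \<partial>M)"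
    by (rule emeasure_pair_measure_alt2[OF S])
  also have "\<dots> = (\<integral>\<^sup>+L. 0 \<partial>M)"
  proof (rule nn_integral_cong)
    fix L assume "L \<in> space M"
    then have L: "L \<in> Xlat" by (simp add: spM)
    have "(\<lambda>t. (t, L)) -` S = {t \<in> space lborel. \<not> act (umat t) L \<notin> A}"
      using L by (auto simp: S_def space_pair_measure space_Xmeas)
    moreover have "(\<lambda>t. (t, L)) -` S \<in> sets lborel" using sets_Pair2[OF S, of L] .
    ultimately show "emeasure lborel ((\<lambda>t. (t, L)) -` S) = 0"
      using null[OF L] AE_iff_measurable[of "(\<lambda>t. (t, L)) -` S" lborel "\<lambda>t. act (umat t) L \<notin> A"] by simp
  qed
  finally have "emeasure M A * \<infinity> = 0" using 1 by simp
  then show ?thesis by (metis ennreal_zero_neq_top infinity_ennreal_def mult_eq_0_iff)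
qed

lemma emeasure_Binf_eq_0:
  assumes "haar_prob M" "continuous_on {s0..} r"
    and null: "\<And>L. L \<in> Xlat \<Longrightarrow> AE t in lborel. \<not> (\<forall>T. \<exists>s\<ge>T. s0 \<le> s \<and> boxfree t L s (r s))"
  shows "emeasure M (Binf r s0) = 0"
proof (rule unipotent_null[OF assms(1) Binf_sets[OF assms(2)]])
  have "{p \<in> space (borel \<Otimes>\<^sub>M Xmeas). act (umat (fst p)) (snd p) \<in> Binf r s0} =
    {p \<in> space (borel \<Otimes>\<^sub>M Xmeas). \<forall>T. \<exists>s\<ge>T. s0 \<le> s \<and> boxfree (fst p) (snd p) s (r s)}"
    by (auto simp: space_pair_measure space_Xmeas act_Binf_iff)
  then show "{p \<in> space (borel \<Otimes>\<^sub>M Xmeas). act (umat (fst p)) (snd p) \<in> Binf r s0} \<in> sets (borel \<Otimes>\<^sub>M Xmeas)"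
    using unbounded_boxfree_pred[OF assms(2)] by (simp add: pred_def)
  show "AE t in lborel. act (umat t) L \<notin> Binf r s0" if "L \<in> Xlat" for L
    using null[OF that] by (simp add: act_Binf_iff[OF that])
qed

lemma emeasure_Binf_eq_1:
  assumes "haar_prob M" "continuous_on {s0..} r"
    and full: "\<And>L. L \<in> Xlat \<Longrightarrow> AE t in lborel. \<forall>T. \<exists>s\<ge>T. s0 \<le> s \<and> boxfree t L s (r s)"
  shows "emeasure M (Binf r s0) = 1"
proof -
  have setsM: "sets M = sets Xmeas" and "prob_space M" using assms(1) by (auto simp: haar_prob_def)
  interpret M: prob_space M by fact
  have spM: "space M = Xlat" using sets_eq_imp_space_eq[OF setsM] by (simp add: space_Xmeas)
  have B: "Binf r s0 \<in> sets Xmeas" by (rule Binf_sets[OF assms(2)])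
  have "emeasure M (Xlat - Binf r s0) = 0"
  proof (rule unipotent_null[OF assms(1)])
    show "Xlat - Binf r s0 \<in> sets Xmeas" using sets.compl_sets[OF B] by (simp add: space_Xmeas)
    have "{p \<in> space (borel \<Otimes>\<^sub>M Xmeas). act (umat (fst p)) (snd p) \<in> Xlat - Binf r s0} =
      {p \<in> space (borel \<Otimes>\<^sub>M Xmeas). \<not> (\<forall>T. \<exists>s\<ge>T. s0 \<le> s \<and> boxfree (fst p) (snd p) s (r s))}"
    proof (rule Collect_cong)
      fix p :: "real \<times> (real^2) set"
      show "p \<in> space (borel \<Otimes>\<^sub>M Xmeas) \<and> act (umat (fst p)) (snd p) \<in> Xlat - Binf r s0 \<longleftrightarrow>
        p \<in> space (borel \<Otimes>\<^sub>M Xmeas) \<and> \<not> (\<forall>T. \<exists>s\<ge>T. s0 \<le> s \<and> boxfree (fst p) (snd p) s (r s))"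
      proof (cases "snd p \<in> Xlat")
        case True
        then show ?thesis unfolding Diff_iff act_Binf_iff[OF True] using act_Xlat[OF umat_SL2 True] by blast
      qed (simp add: space_pair_measure space_Xmeas mem_Times_iff)
    qed
    moreover have "Measurable.pred (borel \<Otimes>\<^sub>M Xmeas) (\<lambda>p. \<not> (\<forall>T. \<exists>s\<ge>T. s0 \<le> s \<and> boxfree (fst p) (snd p) s (r s)))"
      by (intro pred_intros_logic unbounded_boxfree_pred[OF assms(2)])
    ultimately show "{p \<in> space (borel \<Otimes>\<^sub>M Xmeas). act (umat (fst p)) (snd p) \<in> Xlat - Binf r s0} \<in> sets (borel \<Otimes>\<^sub>M Xmeas)"
      by (simp only: pred_def)
    show "AE t in lborel. act (umat t) L \<notin> Xlat - Binf r s0" if "L \<in> Xlat" for L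
      using full[OF that] by eventually_elim (simp add: act_Binf_iff[OF that])
  qed
  then have "emeasure M (space M - Binf r s0) = 0" by (simp add: spM)
  moreover have "emeasure M (space M - Binf r s0) = 1 - emeasure M (Binf r s0)"
    using emeasure_compl[of "Binf r s0" M] B setsM M.emeasure_space_1 by simp
  ultimately have "1 \<le> emeasure M (Binf r s0)" by (simp add: diff_eq_0_iff_ennreal)
  then show ?thesis using M.measure_le_1 M.emeasure_le_1 by (intro antisym) auto
qed

section \<open>The zero-one law\<close>

text \<open>The extra summand r(n) of \<open>rl\<close> has to be absorbed: from m on, log (1/r(n))
  is at least log (1/r(m)) > 0, so r(n) is at most a constant times r(n) log (1/r(n)).\<close>

lemma (in rate) summable_rl_of_summable_on:
  assumes "(\<lambda>n::int. r n * ln (1 / r n)) summable_on {n. s0 \<le> real_of_int n}"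
  shows "summable (\<lambda>n. rl (min 1 (\<rho> n)))"
proof -
  obtain T where T: "\<And>s. s \<ge> T \<Longrightarrow> r s < 1" using small by blast
  define m where "m = nat \<lceil>max s0 T\<rceil>"
  have m: "s0 \<le> real m" "T \<le> real m" unfolding m_def by linarith+
  define g where "g n = r (real (n + m)) * ln (1 / r (real (n + m)))" for n
  have rp: "0 < r (real (n + m))" "r (real (n + m)) < 1" for n using m by (auto intro!: pos T)
  have g0: "0 \<le> g n" for n unfolding g_def using rp[of n] by (intro mult_nonneg_nonneg) auto
  have "(\<lambda>n::int. r n * ln (1 / r n)) summable_on {int m..}"
    by (rule summable_on_subset_banach[OF assms]) (use m in auto)
  moreover have "{int m..} = range (\<lambda>n. int (n + m))"
  proof safe
    fix x assume "int m \<le> x"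
    then have "x = int (nat (x - int m) + m)" by simp
    then show "x \<in> range (\<lambda>n. int (n + m))" by blast
  qed simp
  ultimately have "((\<lambda>n::int. r n * ln (1 / r n)) \<circ> (\<lambda>n. int (n + m))) summable_on UNIV"
    by (subst summable_on_reindex[symmetric]) (auto simp: inj_on_def)
  then have "g summable_on UNIV" by (simp add: g_def[abs_def] comp_def)
  then have gs: "summable g" using summable_on_UNIV_nonneg_real_iff[of g] g0 by blast
  have "summable (\<lambda>n. rl (min 1 (\<rho> (n + m))))"
  proof (rule summable_comparison_test[OF _ summable_mult[OF gs, of "1 + 1 / ln (1 / r (real m))"]], intro exI allI impI)
    fix n
    define x where "x = r (real (n + m))"
    have x: "0 < x" "x < 1" "\<rho> (n + m) = x" using rp m by (auto simp: x_def \<rho>_def max_def)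
    have "r (real (n + m)) \<le> r (real m)" using m by (intro noninc) auto
    then have "ln (1 / r (real m)) \<le> ln (1 / x)" using x rp[of 0] by (simp add: x_def ln_div)
    moreover have l: "0 < ln (1 / r (real m))" using rp[of 0] by simp
    ultimately have "1 \<le> ln (1 / x) / ln (1 / r (real m))" by (simp add: le_divide_eq)
    then have "1 + ln (1 / x) \<le> (1 + 1 / ln (1 / r (real m))) * ln (1 / x)" by (simp add: algebra_simps)
    then have "x * (1 + ln (1 / x)) \<le> x * ((1 + 1 / ln (1 / r (real m))) * ln (1 / x))"
      using x by (intro mult_left_mono) auto
    moreover have "g n = x * ln (1 / x)" by (simp add: g_def x_def)
    moreover have "rl x = x * (1 + ln (1 / x))" using x by (simp add: rl_def ln_div)
    ultimately have "rl x \<le> (1 + 1 / ln (1 / r (real m))) * g n" by (simp only: mult.left_commute)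
    then show "norm (rl (min 1 (\<rho> (n + m)))) \<le> (1 + 1 / ln (1 / r (real m))) * g n"
      using rl_nonneg[of x] x by simp
  qed
  then show ?thesis by (rule summable_iff_shift[THEN iffD1])
qed

text \<open>From m on the terms are non-negative and dominated by \<open>rl\<close>. The integers
  between \<open>s0\<close> and m, possibly negative and with terms of any sign, are finite in
  number and are added back.\<close>

lemma (in rate) summable_on_of_summable_rl:
  assumes "summable (\<lambda>n. rl (min 1 (\<rho> n)))"
  shows "(\<lambda>n::int. r n * ln (1 / r n)) summable_on {n. s0 \<le> real_of_int n}"
proof -
  obtain T where T: "\<And>s. s \<ge> T \<Longrightarrow> r s < 1" using small by blast
  define m where "m = nat \<lceil>max s0 T\<rceil>"
  have m: "s0 \<le> real m" "T \<le> real m" unfolding m_def by linarith+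
  define g where "g n = r (real (n + m)) * ln (1 / r (real (n + m)))" for n
  have rp: "0 < r (real (n + m))" "r (real (n + m)) < 1" for n using m by (auto intro!: pos T)
  have g0: "0 \<le> g n" for n unfolding g_def using rp[of n] by (intro mult_nonneg_nonneg) auto
  have "summable (\<lambda>n. rl (min 1 (\<rho> (n + m))))" using assms by (rule summable_iff_shift[THEN iffD2])
  then have "summable g"
  proof (rule summable_comparison_test[rotated], intro exI allI impI)
    fix n
    have "\<rho> (n + m) = r (real (n + m))" using m by (simp add: \<rho>_def max_def)
    then have "rl (min 1 (\<rho> (n + m))) = r (real (n + m)) + g n"
      using rp[of n] by (simp add: rl_def g_def ln_div algebra_simps)
    then show "norm (g n) \<le> rl (min 1 (\<rho> (n + m)))" using g0[of n] rp[of n] by simp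
  qed
  then have "g summable_on UNIV" using summable_on_UNIV_nonneg_real_iff[of g] g0 by blast
  then have "((\<lambda>n::int. r n * ln (1 / r n)) \<circ> (\<lambda>n. int (n + m))) summable_on UNIV"
    by (simp add: g_def[abs_def] comp_def)
  then have "(\<lambda>n::int. r n * ln (1 / r n)) summable_on range (\<lambda>n. int (n + m))"
    by (subst summable_on_reindex) (auto simp: inj_on_def)
  moreover have "finite {n. s0 \<le> real_of_int n \<and> n < int m}"
    by (rule finite_subset[of _ "{\<lceil>s0\<rceil>..int m}"]) (auto simp: ceiling_le_iff)
  then have "(\<lambda>n::int. r n * ln (1 / r n)) summable_on {n. s0 \<le> real_of_int n \<and> n < int m}"
    by (rule summable_on_finite)
  ultimately have "(\<lambda>n::int. r n * ln (1 / r n)) summable_on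
      (range (\<lambda>n. int (n + m)) \<union> {n. s0 \<le> real_of_int n \<and> n < int m})"
    by (rule summable_on_Un_disjoint) auto
  moreover have "range (\<lambda>n. int (n + m)) \<union> {n. s0 \<le> real_of_int n \<and> n < int m} = {n. s0 \<le> real_of_int n}"
  proof safe
    fix n assume n: "s0 \<le> real_of_int n" "n \<notin> range (\<lambda>n. int (n + m))"
    show "n < int m"
    proof (rule ccontr)
      assume "\<not> n < int m"
      then have "n = int (nat (n - int m) + m)" by simp
      with n(2) show False by blast
    qed
  qed (use m in auto)
  ultimately show ?thesis by simp
qed

theorem theorem1p1:
  fixes r :: "real \<Rightarrow> real" and s0 :: real and M :: "(real^2) set measure"
  assumes mu: "haar_prob M"
    and cont: "continuous_on {s0..} r"
    and pos: "\<forall>s \<ge> s0. r s > 0"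
    and noninc: "\<forall>s t. s0 \<le> s \<longrightarrow> s \<le> t \<longrightarrow> r t \<le> r s"
    and small: "\<exists>T. \<forall>s \<ge> T. r s < 1"
  shows "((\<lambda>n::int. r n * ln (1 / r n)) summable_on {n. s0 \<le> real_of_int n}
            \<longrightarrow> Binf r s0 \<in> sets M \<and> emeasure M (Binf r s0) = 0)
       \<and> ((\<forall>s t. s0 \<le> s \<longrightarrow> s \<le> t \<longrightarrow> s + r s \<le> t + r t)
            \<longrightarrow> \<not> (\<lambda>n::int. r n * ln (1 / r n)) summable_on {n. s0 \<le> real_of_int n}
            \<longrightarrow> Binf r s0 \<in> sets M \<and> emeasure M (Binf r s0) = 1)"
proof -
  interpret rate r s0 using pos noninc small by unfold_locales auto
  have B: "Binf r s0 \<in> sets M" using mu Binf_sets[OF cont] by (simp add: haar_prob_def)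
  have "emeasure M (Binf r s0) = 0" if "(\<lambda>n::int. r n * ln (1 / r n)) summable_on {n. s0 \<le> real_of_int n}"
  proof (rule emeasure_Binf_eq_0[OF mu cont])
    fix L assume "L \<in> Xlat"
    from AE_not_boxfree[OF this summable_rl_of_summable_on[OF that]]
    show "AE t in lborel. \<not> (\<forall>T. \<exists>s\<ge>T. s0 \<le> s \<and> boxfree t L s (r s))" by eventually_elim blast
  qed
  moreover have "emeasure M (Binf r s0) = 1" if "\<not> (\<lambda>n::int. r n * ln (1 / r n)) summable_on {n. s0 \<le> real_of_int n}"
    using that summable_on_of_summable_rl by (intro emeasure_Binf_eq_1[OF mu cont] AE_boxfree) blast+
  ultimately show ?thesis using B by blast
qed

end
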